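(* Let $F,\|\cdot\|,\psi,q,\tau,L,\kappa,\mu$ satisfy the Assumption in the context, and suppose $\kappa<q$. Let $B>0$ satisfy $\frac1\mu D_\psi(x_\star,x_1)\le B$. Put $q_\ast=\frac{q}{q-1}$, $r:=\frac{q-\kappa}{\kappa}$, $M:=\left(\frac{r}{q}\right)^r$, $\beta:=q-\kappa+\frac{q-\kappa}{q}$, $$\alpha:=\frac{\mu}{L}\left(\frac{(q-\kappa)B}{\kappa}\right)^{\frac{q-\kappa}{q}},$$ and, for $t\ge1$, $$\alpha_t:=\big(\tau(q-\beta)\big)^{q-\kappa}\frac{\alpha}{t^{\beta}},\qquad \eta_t:=\alpha_t\Big(\frac{t}{\tau(q-\beta)}\Big)^{q-1},\qquad C_t:=\Big(\frac{\eta_t}{\alpha_t}\Big)^{q_\ast-1}-\frac1\tau,\qquad \epsilon_t:=\frac{\alpha^{\frac{q}{q-\kappa}}}{t\,\eta_t}\,\frac{M^{1/r}}{\mu^{1/r}}\,L^{1+1/r}.$$ Run Algorithm 1 (with Algorithm 2 as its binary search; see context) for $T$ iterations with these parameters. Then its output satisfies $$F(x_{T+1}^{ag})-F_\star=\mathcal{O}_{q,\kappa}\left(L\,\tau^q\,B^{\frac{\kappa}{q}}\,\frac{\log T}{T^{\frac{\kappa q+\kappa-q}{q}}}\right),$$ and the total number of first-order oracle calls (evaluations of $F$ and $\nabla F$) made during the whole execution over $T$ iterations is at most $\mathcal{O}\big(T\log(LB\tau T)\big)$.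
   Context: Notation: $f(T)=\mathcal{O}(h(T))$ means that there are $M_0,T_0>0$ with $|f(T)|\le M_0h(T)$ for all $T\ge T_0$; in $\mathcal{O}_{q,\kappa}$ the constant $M_0$ depends only on $(q,\kappa)$. For a continuously differentiable $G:\mathbb{R}^d\to\mathbb{R}$ the Bregman divergence is $D_G(x,y):=G(x)-G(y)-\langle\nabla G(y),x-y\rangle$ (convexity of $G$ is not assumed). Assumption. $\|\cdot\|$ is an arbitrary norm on $\mathbb{R}^d$; $F,\psi:\mathbb{R}^d\to\mathbb{R}$ are continuously differentiable; $q\ge2$, $1<\kappa\le2$, $\tau,L,\mu>0$; and - $F$ is $\tau$-star-convex: there exists $x_\star\in\arg\min F$ such that $\tau\langle\nabla F(x),x-x_\star\rangle\ge F(x)-F(x_\star)$ for all $x\in\mathbb{R}^d$. Write $F_\star=F(x_\star)$ for this $x_\star$. - $F$ is $(L,\kappa)$-weakly smooth with respect to $\|\cdot\|$: $|D_F(x,y)|\le\frac{L}{\kappa}\|x-y\|^\kappa$ for all $x,y$. - $\psi$ is $(\mu,q)$-uniformly convex with respect to $\|\cdot\|$: $D_\psi(x,y)\ge\frac{\mu}{q}\|x-y\|^q$ for all $x,y$. Algorithm 1 (accelerated mirror descent with binary search). Input: a starting point $x_1=x_1^{ag}\in\mathbb{R}^d$, number of iterations $T$, parameters $(C_t,\epsilon_t,\alpha_t,\eta_t)_{t\ge1}$. For $t=1,\dots,T$: 1. by Algorithm 2 with endpoints $(x_t,x_t^{ag})$ and parameters $(C_t,\epsilon_t)$, find $\lambda_t\in[0,1]$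 such that, with $x_t^{md}=\lambda_tx_t^{ag}+(1-\lambda_t)x_t$, one has $\langle\nabla F(x_t^{md}),x_t^{md}-x_t\rangle+C_t\big(F(x_t^{md})-F(x_t^{ag})\big)\le\epsilon_t$; 2. $x_{t+1}=\arg\min_{x\in\mathbb{R}^d}\{\eta_t\langle\nabla F(x_t^{md}),x\rangle+D_\psi(x,x_t)\}$; 3. $x_{t+1}^{ag}\in\arg\min_{x\in\mathbb{R}^d}\{\alpha_t\langle\nabla F(x_t^{md}),x\rangle+\frac{\mu}{q}\|x-x_t^{md}\|^q\}$ (any minimizer). Output $x_{T+1}^{ag}$. Algorithm 2 (generalized binary search). Input: $F$, endpoints $x_t,x_t^{ag}$, parameters $C_t,\epsilon_t$. Let $g(\lambda)=F(\lambda x_t^{ag}+(1-\lambda)x_t)-F(x_t^{ag})$. If $g'(1)\le\epsilon_t$, return $\lambda=1$. Else if $C_tg(0)\le\epsilon_t$, return $\lambda=0$. Otherwise initialize $[a,b]=[0,1]$ and loop: set $\lambda=\frac{a+b}{2}$; if $\lambda g'(\lambda)+C_tg(\lambda)\le\epsilon_t$, return $\lambda$; else if $g(\lambda)>0$, replace $a$ by $\lambda$; else replace $b$ by $\lambda$. *)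

theory Defs
  imports "HOL-Analysis.Analysis" "HOL-Analysis.Finite_Function_Topology"
begin

section \<open>The space \<open>\<real>\<^sup>d\<close>\<close>

text \<open>
  The constants hidden in the complexity bounds must not depend on the dimension, so the dimension
  is a natural number that can be quantified inside a formula rather than a type. All the spaces
  \<open>\<real>\<^sup>d\<close> live in the normed space of finitely supported real sequences; the induced topology on
  \<open>Rd d\<close> is the usual one, so derivatives within \<open>Rd d\<close> are the usual Frechet derivatives.
\<close>

type_synonym vec = "nat \<Rightarrow>\<^sub>0 real"

definition Rd :: "nat \<Rightarrow> vec set" where
  "Rd d = {x. \<forall>i\<ge>d. Poly_Mapping.lookup x i = 0}"

definition ip :: "nat \<Rightarrow> vec \<Rightarrow> vec \<Rightarrow> real" where
  "ip d x y = (\<Sum>i<d. Poly_Mapping.lookup x i * Poly_Mapping.lookup y i)"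

definition norm_on_Rd :: "nat \<Rightarrow> (vec \<Rightarrow> real) \<Rightarrow> bool" where
  "norm_on_Rd d N \<longleftrightarrow>
     (\<forall>x\<in>Rd d. 0 \<le> N x \<and> (N x = 0 \<longleftrightarrow> x = 0)) \<and>
     (\<forall>c. \<forall>x\<in>Rd d. N (c *\<^sub>R x) = \<bar>c\<bar> * N x) \<and>
     (\<forall>x\<in>Rd d. \<forall>y\<in>Rd d. N (x + y) \<le> N x + N y)"

definition C1_with_gradient :: "nat \<Rightarrow> (vec \<Rightarrow> real) \<Rightarrow> (vec \<Rightarrow> vec) \<Rightarrow> bool" where
  "C1_with_gradient d G gradG \<longleftrightarrow>
     (\<forall>x\<in>Rd d. gradG x \<in> Rd d \<and> (G has_derivative ip d (gradG x)) (at x within Rd d)) \<and>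
     continuous_on (Rd d) gradG"

definition bregman :: "nat \<Rightarrow> (vec \<Rightarrow> real) \<Rightarrow> (vec \<Rightarrow> vec) \<Rightarrow> vec \<Rightarrow> vec \<Rightarrow> real" where
  "bregman d G gradG x y = G x - G y - ip d (gradG y) (x - y)"


section \<open>Standing assumptions\<close>

definition star_convex_at ::
  "nat \<Rightarrow> (vec \<Rightarrow> real) \<Rightarrow> (vec \<Rightarrow> vec) \<Rightarrow> real \<Rightarrow> vec \<Rightarrow> bool" where
  "star_convex_at d F gF \<tau> xs \<longleftrightarrow>
     is_arg_min F (\<lambda>x. x \<in> Rd d) xs \<and>
     (\<forall>x\<in>Rd d. \<tau> * ip d (gF x) (x - xs) \<ge> F x - F xs)"

definition weakly_smooth ::
  "nat \<Rightarrow> (vec \<Rightarrow> real) \<Rightarrow> (vec \<Rightarrow> real) \<Rightarrow> (vec \<Rightarrow> vec) \<Rightarrow> real \<Rightarrow> real \<Rightarrow> bool" where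
  "weakly_smooth d N F gF L \<kappa> \<longleftrightarrow>
     (\<forall>x\<in>Rd d. \<forall>y\<in>Rd d. \<bar>bregman d F gF x y\<bar> \<le> L / \<kappa> * N (x - y) powr \<kappa>)"

definition uniformly_convex ::
  "nat \<Rightarrow> (vec \<Rightarrow> real) \<Rightarrow> (vec \<Rightarrow> real) \<Rightarrow> (vec \<Rightarrow> vec) \<Rightarrow> real \<Rightarrow> real \<Rightarrow> bool" where
  "uniformly_convex d N \<psi> g\<psi> \<mu> q \<longleftrightarrow>
     (\<forall>x\<in>Rd d. \<forall>y\<in>Rd d. bregman d \<psi> g\<psi> x y \<ge> \<mu> / q * N (x - y) powr q)"

definition standing_assumption ::
  "nat \<Rightarrow> (vec \<Rightarrow> real) \<Rightarrow> (vec \<Rightarrow> real) \<Rightarrow> (vec \<Rightarrow> vec) \<Rightarrow> (vec \<Rightarrow> real) \<Rightarrow> (vec \<Rightarrow> vec) \<Rightarrow>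
   real \<Rightarrow> real \<Rightarrow> real \<Rightarrow> real \<Rightarrow> real \<Rightarrow> vec \<Rightarrow> bool" where
  "standing_assumption d N F gF \<psi> g\<psi> q \<kappa> \<tau> L \<mu> xs \<longleftrightarrow>
     norm_on_Rd d N \<and> C1_with_gradient d F gF \<and> C1_with_gradient d \<psi> g\<psi> \<and>
     2 \<le> q \<and> 1 < \<kappa> \<and> \<kappa> \<le> 2 \<and> 0 < \<tau> \<and> 0 < L \<and> 0 < \<mu> \<and>
     star_convex_at d F gF \<tau> xs \<and>
     weakly_smooth d N F gF L \<kappa> \<and>
     uniformly_convex d N \<psi> g\<psi> \<mu> q"


section \<open>Generalized binary search\<close>

text \<open>
  \<open>binary_search g C \<epsilon> l n\<close>: the search on \<open>g\<close> halts, returns \<open>l\<close> and makes \<open>n\<close> oracle calls.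
  Evaluations of \<open>F\<close> and of \<open>\<nabla>F\<close> are counted separately. For \<open>g = segment_gap F x xag\<close>,
  \<open>g' l\<close> is an inner product with \<open>\<nabla>F\<close> at one point (1 call) and \<open>g l\<close> needs \<open>F\<close> at two points
  (2 calls); within one pass of the loop these values are reused, between passes nothing is.
  A search that never halts has no derivation, so halting is the existence of \<open>l\<close> and \<open>n\<close>.
\<close>

definition segment_point :: "vec \<Rightarrow> vec \<Rightarrow> real \<Rightarrow> vec" where
  "segment_point x xag l = l *\<^sub>R xag + (1 - l) *\<^sub>R x"

definition segment_gap :: "(vec \<Rightarrow> real) \<Rightarrow> vec \<Rightarrow> vec \<Rightarrow> real \<Rightarrow> real" where
  "segment_gap F x xag l = F (segment_point x xag l) - F xag"

inductive search_loop ::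
  "(real \<Rightarrow> real) \<Rightarrow> real \<Rightarrow> real \<Rightarrow> real \<Rightarrow> real \<Rightarrow> real \<Rightarrow> nat \<Rightarrow> bool"
  for g C \<epsilon> where
  found: "l = (a + b) / 2 \<Longrightarrow> l * deriv g l + C * g l \<le> \<epsilon> \<Longrightarrow> search_loop g C \<epsilon> a b l 3"
| upper: "l = (a + b) / 2 \<Longrightarrow> \<not> l * deriv g l + C * g l \<le> \<epsilon> \<Longrightarrow> g l > 0 \<Longrightarrow>
    search_loop g C \<epsilon> l b l' n \<Longrightarrow> search_loop g C \<epsilon> a b l' (n + 3)"
| lower: "l = (a + b) / 2 \<Longrightarrow> \<not> l * deriv g l + C * g l \<le> \<epsilon> \<Longrightarrow> \<not> g l > 0 \<Longrightarrow>
    search_loop g C \<epsilon> a l l' n \<Longrightarrow> search_loop g C \<epsilon> a b l' (n + 3)"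

inductive binary_search :: "(real \<Rightarrow> real) \<Rightarrow> real \<Rightarrow> real \<Rightarrow> real \<Rightarrow> nat \<Rightarrow> bool"
  for g C \<epsilon> where
  one: "deriv g 1 \<le> \<epsilon> \<Longrightarrow> binary_search g C \<epsilon> 1 1"
| zero: "\<not> deriv g 1 \<le> \<epsilon> \<Longrightarrow> C * g 0 \<le> \<epsilon> \<Longrightarrow> binary_search g C \<epsilon> 0 3"
| loop: "\<not> deriv g 1 \<le> \<epsilon> \<Longrightarrow> \<not> C * g 0 \<le> \<epsilon> \<Longrightarrow> search_loop g C \<epsilon> 0 1 l n \<Longrightarrow>
    binary_search g C \<epsilon> l (n + 3)"


section \<open>Accelerated mirror descent\<close>

text \<open>
  \<open>amd_run \<dots> T x xag calls\<close>: iterations \<open>1, \<dots>, T\<close> have been completed, with iterates \<open>x\<close>, \<open>xag\<close>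
  (indexed from 1), iteration \<open>t\<close> making \<open>calls t\<close> oracle calls. The additional call in
  \<open>calls t\<close> is the evaluation of \<open>\<nabla>F\<close> at \<open>xmd\<close> shared by the last two steps.
\<close>

definition amd_iteration ::
  "nat \<Rightarrow> (vec \<Rightarrow> real) \<Rightarrow> (vec \<Rightarrow> real) \<Rightarrow> (vec \<Rightarrow> vec) \<Rightarrow> (vec \<Rightarrow> real) \<Rightarrow> (vec \<Rightarrow> vec) \<Rightarrow>
   real \<Rightarrow> real \<Rightarrow> real \<Rightarrow> real \<Rightarrow> real \<Rightarrow> real \<Rightarrow> vec \<Rightarrow> vec \<Rightarrow> vec \<Rightarrow> vec \<Rightarrow> nat \<Rightarrow> bool" where
  "amd_iteration d N F gF \<psi> g\<psi> q \<mu> C \<epsilon> \<alpha> \<eta> x xag x' xag' n \<longleftrightarrow>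
     (\<exists>l m. let xmd = segment_point x xag l in
        binary_search (segment_gap F x xag) C \<epsilon> l m \<and> n = m + 1 \<and>
        is_arg_min (\<lambda>y. \<eta> * ip d (gF xmd) y + bregman d \<psi> g\<psi> y x) (\<lambda>y. y \<in> Rd d) x' \<and>
        is_arg_min (\<lambda>y. \<alpha> * ip d (gF xmd) y + \<mu> / q * N (y - xmd) powr q)
          (\<lambda>y. y \<in> Rd d) xag')"

definition amd_run ::
  "nat \<Rightarrow> (vec \<Rightarrow> real) \<Rightarrow> (vec \<Rightarrow> real) \<Rightarrow> (vec \<Rightarrow> vec) \<Rightarrow> (vec \<Rightarrow> real) \<Rightarrow> (vec \<Rightarrow> vec) \<Rightarrow>
   real \<Rightarrow> real \<Rightarrow> (nat \<Rightarrow> real) \<Rightarrow> (nat \<Rightarrow> real) \<Rightarrow> (nat \<Rightarrow> real) \<Rightarrow> (nat \<Rightarrow> real) \<Rightarrow> vec \<Rightarrow>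
   nat \<Rightarrow> (nat \<Rightarrow> vec) \<Rightarrow> (nat \<Rightarrow> vec) \<Rightarrow> (nat \<Rightarrow> nat) \<Rightarrow> bool" where
  "amd_run d N F gF \<psi> g\<psi> q \<mu> C \<epsilon> \<alpha> \<eta> x1 T x xag calls \<longleftrightarrow>
     x 1 = x1 \<and> xag 1 = x1 \<and>
     (\<forall>t\<in>{1..T}. amd_iteration d N F gF \<psi> g\<psi> q \<mu> (C t) (\<epsilon> t) (\<alpha> t) (\<eta> t)
        (x t) (xag t) (x (Suc t)) (xag (Suc t)) (calls t))"


section \<open>Choice of parameters\<close>

definition r_par :: "real \<Rightarrow> real \<Rightarrow> real" where
  "r_par q \<kappa> = (q - \<kappa>) / \<kappa>"

definition M_par :: "real \<Rightarrow> real \<Rightarrow> real" where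
  "M_par q \<kappa> = (r_par q \<kappa> / q) powr r_par q \<kappa>"

definition beta_par :: "real \<Rightarrow> real \<Rightarrow> real" where
  "beta_par q \<kappa> = q - \<kappa> + (q - \<kappa>) / q"

definition alpha_par :: "real \<Rightarrow> real \<Rightarrow> real \<Rightarrow> real \<Rightarrow> real \<Rightarrow> real" where
  "alpha_par q \<kappa> L \<mu> B = \<mu> / L * ((q - \<kappa>) * B / \<kappa>) powr ((q - \<kappa>) / q)"

definition alpha_seq :: "real \<Rightarrow> real \<Rightarrow> real \<Rightarrow> real \<Rightarrow> real \<Rightarrow> real \<Rightarrow> nat \<Rightarrow> real" where
  "alpha_seq q \<kappa> \<tau> L \<mu> B t =
     (\<tau> * (q - beta_par q \<kappa>)) powr (q - \<kappa>) * (alpha_par q \<kappa> L \<mu> B / real t powr beta_par q \<kappa>)"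

definition eta_seq :: "real \<Rightarrow> real \<Rightarrow> real \<Rightarrow> real \<Rightarrow> real \<Rightarrow> real \<Rightarrow> nat \<Rightarrow> real" where
  "eta_seq q \<kappa> \<tau> L \<mu> B t =
     alpha_seq q \<kappa> \<tau> L \<mu> B t * (real t / (\<tau> * (q - beta_par q \<kappa>))) powr (q - 1)"

definition C_seq :: "real \<Rightarrow> real \<Rightarrow> real \<Rightarrow> real \<Rightarrow> real \<Rightarrow> real \<Rightarrow> nat \<Rightarrow> real" where
  "C_seq q \<kappa> \<tau> L \<mu> B t =
     (eta_seq q \<kappa> \<tau> L \<mu> B t / alpha_seq q \<kappa> \<tau> L \<mu> B t) powr (q / (q - 1) - 1) - 1 / \<tau>"

definition eps_seq :: "real \<Rightarrow> real \<Rightarrow> real \<Rightarrow> real \<Rightarrow> real \<Rightarrow> real \<Rightarrow> nat \<Rightarrow> real" where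
  "eps_seq q \<kappa> \<tau> L \<mu> B t =
     alpha_par q \<kappa> L \<mu> B powr (q / (q - \<kappa>)) / (real t * eta_seq q \<kappa> \<tau> L \<mu> B t) *
     (M_par q \<kappa> powr (1 / r_par q \<kappa>) / \<mu> powr (1 / r_par q \<kappa>)) *
     L powr (1 + 1 / r_par q \<kappa>)"

text \<open>The algorithm run for \<open>T\<close> iterations with these parameters.\<close>

definition tuned_run ::
  "nat \<Rightarrow> (vec \<Rightarrow> real) \<Rightarrow> (vec \<Rightarrow> real) \<Rightarrow> (vec \<Rightarrow> vec) \<Rightarrow> (vec \<Rightarrow> real) \<Rightarrow> (vec \<Rightarrow> vec) \<Rightarrow>
   real \<Rightarrow> real \<Rightarrow> real \<Rightarrow> real \<Rightarrow> real \<Rightarrow> real \<Rightarrow> vec \<Rightarrow>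
   nat \<Rightarrow> (nat \<Rightarrow> vec) \<Rightarrow> (nat \<Rightarrow> vec) \<Rightarrow> (nat \<Rightarrow> nat) \<Rightarrow> bool" where
  "tuned_run d N F gF \<psi> g\<psi> q \<kappa> \<tau> L \<mu> B x1 T x xag calls \<longleftrightarrow>
     amd_run d N F gF \<psi> g\<psi> q \<mu> (C_seq q \<kappa> \<tau> L \<mu> B) (eps_seq q \<kappa> \<tau> L \<mu> B)
       (alpha_seq q \<kappa> \<tau> L \<mu> B) (eta_seq q \<kappa> \<tau> L \<mu> B) x1 T x xag calls"

end

theory Submission
  imports Defs
begin

text \<open>
  Write \<open>\<delta> t\<close> for the gap \<open>F (xag t) - F xs\<close> and \<open>D t\<close> for the Bregman divergence of \<open>xs\<close> from
  \<open>x t\<close>.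

  \<^bold>\<open>Rate.\<close> Let \<open>\<theta> t = t / (\<tau> * P)\<close> with \<open>P = q - \<beta> = \<kappa> - 1 + \<kappa> / q\<close>. One iteration satisfies
  \<open>\<eta> t * \<theta> t * \<delta> (t + 1) + D (t + 1) \<le> (\<eta> t * \<theta> t - \<eta> t / \<tau>) * \<delta> t + D t + errors\<close>
  (\<open>iteration_inequality\<close>): star-convexity and the stopping test of the search bound the gap at
  the search point, and the decrease achieved by the step to the aggregated point pays for the
  movement of the mirror step. The errors are the weighted tolerance of the search and the loss
  from the two different exponents \<open>\<kappa> < q\<close>; the parameters make both of them equal to \<open>err / t\<close>,
  and make \<open>\<eta> t * \<theta> t = W * t powr P\<close> and \<open>\<eta> t / \<tau> = W * P * t powr (P - 1)\<close>. So the weight of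
  \<open>\<delta> t\<close> on the right is, up to a factor \<open>1 + O(1 / t\<^sup>2)\<close>, at most the weight that \<open>\<delta> t\<close> had one
  step earlier (\<open>weight_decrease\<close>), and the inequalities telescope (\<open>potential_bound\<close>):
  \<open>W * T powr P * \<delta> (T + 1)\<close> is at most a constant times \<open>err * ln T\<close> plus a constant depending on
  the problem. Evaluating \<open>err / W\<close> gives the claimed rate with \<open>\<tau> powr \<kappa>\<close> in place of \<open>\<tau> powr q\<close>.
  These are comparable where it matters: if \<open>F\<close> is not constant then \<open>\<kappa> * \<tau> \<ge> 1\<close>, since
  star-convexity forces \<open>F\<close> to grow like \<open>s powr (1 / \<tau>)\<close> along rays while smoothness allows only
  \<open>s powr \<kappa>\<close> (\<open>tau_lower_bound\<close>).

  \<^bold>\<open>Oracle calls.\<close> The search keeps a bracket \<open>[a, b]\<close> with \<open>g a > 0 \<ge> g b\<close> on which the test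
  fails at \<open>b\<close>. Such a bracket contains a critical point of \<open>g\<close>, while the derivative at \<open>b\<close>
  exceeds \<open>\<epsilon>\<close>; as the derivative is Hoelder continuous, the bracket cannot be short
  (\<open>bracket_not_short\<close>). Hence the number of passes is logarithmic in the Hoelder constant divided
  by \<open>\<epsilon>\<close>. The Hoelder constant involves the distance between the two endpoints, and this grows at
  most polynomially in \<open>t\<close> (\<open>iterates_polynomially_bounded\<close>), with an exponent that depends on \<open>q\<close>
  and \<open>\<kappa>\<close> only. Therefore iteration \<open>t\<close> makes at most \<open>H + c * ln t\<close> calls, where only \<open>H\<close> depends
  on the problem, and for large \<open>T\<close> the logarithm dominates \<open>H\<close>.
\<close>

section \<open>Bisection on a segment\<close>

text \<open>
  A short bracket cannot survive the test at its right end. The test fails at \<open>b\<close> although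
  \<open>C * g b \<le> 0\<close>, so \<open>g' b > \<epsilon>\<close>; on the other hand \<open>g\<close> is larger at \<open>a\<close> than at \<open>b\<close> and increases
  at \<open>b\<close>, so it has a critical point inside the bracket. A derivative that is Hoelder continuous
  with exponent \<open>\<kappa> - 1\<close> needs room to climb from \<open>0\<close> to \<open>\<epsilon>\<close>.
\<close>

lemma bracket_not_short:
  fixes g :: "real \<Rightarrow> real"
  assumes der: "\<And>s. (g has_real_derivative g' s) (at s)"
    and hoelder: "\<And>s t. \<bar>g s - g t - g' t * (s - t)\<bar> \<le> K * \<bar>s - t\<bar> powr \<kappa>"
    and "0 \<le> K" "1 < \<kappa>" "0 \<le> C" "0 < \<epsilon>"
    and "0 \<le> a" "a < b" "b \<le> 1" "0 < g a" "g b \<le> 0" "\<epsilon> < b * g' b + C * g b"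
  shows "\<epsilon> < 2 * K * (b - a) powr (\<kappa> - 1)"
proof -
  have "C * g b \<le> 0"
    using assms by (simp add: mult_nonneg_nonpos)
  then have eps: "\<epsilon> < b * g' b"
    using assms by linarith
  then have g'b: "0 < g' b"
    using assms by (metis less_le_trans linorder_not_less mult_nonneg_nonpos order_less_le)
  obtain c where c: "c \<in> {a..b}" and c_min: "\<And>y. y \<in> {a..b} \<Longrightarrow> g c \<le> g y"
    using continuous_attains_inf[of "{a..b}" g] \<open>a < b\<close> DERIV_isCont[OF der]
    by (force intro: continuous_at_imp_continuous_on)
  have "c \<noteq> a"
    using c_min[of b] \<open>a < b\<close> \<open>0 < g a\<close> \<open>g b \<le> 0\<close> by force
  moreover have "c \<noteq> b"
  proof
    assume "c = b"
    obtain h0 where h0: "h0 > 0" "\<And>h. 0 < h \<Longrightarrow> h < h0 \<Longrightarrow> g (b - h) < g b"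
      using DERIV_pos_inc_left[OF der g'b] by blast
    define h where "h = min (h0 / 2) (b - a)"
    have "0 < h" "h < h0" "b - h \<in> {a..b}"
      using h0(1) \<open>a < b\<close> by (auto simp: h_def)
    then show False
      using h0(2)[of h] c_min[of "b - h"] \<open>c = b\<close> by force
  qed
  ultimately have c': "a < c" "c < b"
    using c by auto
  have "g' c = 0"
  proof (rule DERIV_local_min[OF der])
    show "0 < min (c - a) (b - c)"
      using c' by simp
    show "\<forall>y. \<bar>c - y\<bar> < min (c - a) (b - c) \<longrightarrow> g c \<le> g y"
      using c_min by (auto simp: abs_less_iff)
  qed
  \<comment> \<open>Adding the two Taylor estimates between \<open>b\<close> and \<open>c\<close> cancels the function values.\<close>
  have "g' b * (b - c) \<le> 2 * K * (b - c) powr \<kappa>"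
    using hoelder[of b c] hoelder[of c b] c' \<open>g' c = 0\<close>
    by (auto simp: abs_if algebra_simps split: if_splits)
  also have "\<dots> = 2 * K * (b - c) powr (\<kappa> - 1) * (b - c)"
    using c' by (simp add: powr_diff)
  finally have "g' b \<le> 2 * K * (b - c) powr (\<kappa> - 1)"
    using c' by simp
  also have "\<dots> \<le> 2 * K * (b - a) powr (\<kappa> - 1)"
    using c' assms by (intro mult_left_mono powr_mono2) auto
  finally show ?thesis
    using eps g'b assms(7-9) mult_right_mono[of b 1 "g' b"] by linarith
qed

text \<open>
  Each pass halves the bracket and keeps its sign pattern, while by the previous lemma no such
  bracket has length \<open>w\<close> or less. A bound on the length of all runs says nothing if the search has
  no run, so the same induction also yields a run.
\<close>

lemma search_loop_halts:
  fixes g :: "real \<Rightarrow> real"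
  assumes der: "\<And>s. (g has_real_derivative g' s) (at s)"
    and hoelder: "\<And>s t. \<bar>g s - g t - g' t * (s - t)\<bar> \<le> K * \<bar>s - t\<bar> powr \<kappa>"
    and "0 \<le> K" "1 < \<kappa>" "0 \<le> C" "0 < \<epsilon>" and w: "0 < w" "2 * K * w powr (\<kappa> - 1) \<le> \<epsilon>"
    and "0 \<le> a" "a < b" "b \<le> 1" "0 < g a" "g b \<le> 0" "\<epsilon> < b * g' b + C * g b"
    and "b - a \<le> 2 ^ k * w"
  shows "(\<exists>l n. search_loop g C \<epsilon> a b l n) \<and> (\<forall>l n. search_loop g C \<epsilon> a b l n \<longrightarrow> n \<le> 3 * k)"
  using assms(9-)
proof (induction k arbitrary: a b)
  case 0
  have "\<epsilon> < 2 * K * (b - a) powr (\<kappa> - 1)"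
    using 0 assms by (intro bracket_not_short[OF der hoelder]) auto
  also have "\<dots> \<le> 2 * K * w powr (\<kappa> - 1)"
    using 0 assms(3,4) by (intro mult_left_mono powr_mono2) auto
  finally show ?case
    using w by simp
next
  case (Suc k)
  define m where "m = (a + b) / 2"
  have m: "a < m" "m < b" "m - a \<le> 2 ^ k * w" "b - m \<le> 2 ^ k * w"
    using Suc.prems by (auto simp: m_def field_simps)
  have deriv_g: "deriv g s = g' s" for s
    using DERIV_imp_deriv[OF der] .
  consider "m * deriv g m + C * g m \<le> \<epsilon>"
    | "\<not> m * deriv g m + C * g m \<le> \<epsilon>" "g m > 0" | "\<not> m * deriv g m + C * g m \<le> \<epsilon>" "\<not> g m > 0"
    by blast
  then show ?case
  proof cases
    case 1
    then show ?thesis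
      using search_loop.found[OF m_def] by (force elim: search_loop.cases simp: m_def)
  next
    case 2
    have "(\<exists>l n. search_loop g C \<epsilon> m b l n) \<and> (\<forall>l n. search_loop g C \<epsilon> m b l n \<longrightarrow> n \<le> 3 * k)"
      using 2 m Suc.prems by (intro Suc.IH) auto
    moreover from this have "\<exists>l n. search_loop g C \<epsilon> a b l n"
      using search_loop.upper[OF m_def 2] by blast
    moreover have "n \<le> 3 * Suc k" if "search_loop g C \<epsilon> a b l n" for l n
      using that calculation(1) 2 by cases (auto simp flip: m_def)
    ultimately show ?thesis
      by blast
  next
    case 3
    have "(\<exists>l n. search_loop g C \<epsilon> a m l n) \<and> (\<forall>l n. search_loop g C \<epsilon> a m l n \<longrightarrow> n \<le> 3 * k)"
      using 3 m Suc.prems by (intro Suc.IH) (auto simp: deriv_g)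
    moreover from this have "\<exists>l n. search_loop g C \<epsilon> a b l n"
      using search_loop.lower[OF m_def 3] by blast
    moreover have "n \<le> 3 * Suc k" if "search_loop g C \<epsilon> a b l n" for l n
      using that calculation(1) 3 by cases (auto simp flip: m_def)
    ultimately show ?thesis
      by blast
  qed
qed

lemma binary_search_halts:
  fixes g :: "real \<Rightarrow> real"
  assumes der: "\<And>s. (g has_real_derivative g' s) (at s)"
    and hoelder: "\<And>s t. \<bar>g s - g t - g' t * (s - t)\<bar> \<le> K * \<bar>s - t\<bar> powr \<kappa>"
    and "0 \<le> K" "1 < \<kappa>" "0 \<le> C" "0 < \<epsilon>" and w: "0 < w" "2 * K * w powr (\<kappa> - 1) \<le> \<epsilon>"
    and "g 1 = 0" and k: "1 \<le> 2 ^ k * w"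
  shows "(\<exists>l n. binary_search g C \<epsilon> l n) \<and> (\<forall>l n. binary_search g C \<epsilon> l n \<longrightarrow> n \<le> 3 * k + 3)"
proof -
  have loop: "(\<exists>l n. search_loop g C \<epsilon> 0 1 l n) \<and> (\<forall>l n. search_loop g C \<epsilon> 0 1 l n \<longrightarrow> n \<le> 3 * k)"
    if "\<not> deriv g 1 \<le> \<epsilon>" "\<not> C * g 0 \<le> \<epsilon>"
  proof -
    have "0 < C * g 0"
      using that \<open>0 < \<epsilon>\<close> by linarith
    then have "0 < g 0"
      using \<open>0 \<le> C\<close> by (simp add: zero_less_mult_iff)
    then show ?thesis
      using that assms DERIV_imp_deriv[OF der[of 1]]
      by (intro search_loop_halts[OF der hoelder]) auto
  qed
  have "\<exists>l n. binary_search g C \<epsilon> l n"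
    using loop binary_search.intros[of g \<epsilon> C] by metis
  moreover have "n \<le> 3 * k + 3" if "binary_search g C \<epsilon> l n" for l n
    using that loop by cases auto
  ultimately show ?thesis
    by blast
qed

lemma binary_search_condition:
  assumes "binary_search g C \<epsilon> l n" "g 1 = 0"
  shows "0 \<le> l \<and> l \<le> 1 \<and> l * deriv g l + C * g l \<le> \<epsilon>"
proof -
  have *: "a \<le> l \<and> l \<le> b \<and> l * deriv g l + C * g l \<le> \<epsilon>"
    if "search_loop g C \<epsilon> a b l n" "a \<le> b" for a b l n
    using that by induction auto
  show ?thesis
    using assms *[of 0 1] by cases auto
qed

section \<open>Calculus on \<open>\<real>\<^sup>d\<close>\<close>

lemma Rd_0 [simp]: "0 \<in> Rd d"
  and Rd_add [simp]: "x \<in> Rd d \<Longrightarrow> y \<in> Rd d \<Longrightarrow> x + y \<in> Rd d"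
  and Rd_diff [simp]: "x \<in> Rd d \<Longrightarrow> y \<in> Rd d \<Longrightarrow> x - y \<in> Rd d"
  and Rd_minus [simp]: "x \<in> Rd d \<Longrightarrow> - x \<in> Rd d"
  by (auto simp: Rd_def lookup_add lookup_minus)

lemma lookup_scaleR [simp]: 
  "Poly_Mapping.lookup (c *\<^sub>R (x :: 'a \<Rightarrow>\<^sub>0 'b :: real_vector)) i = c *\<^sub>R Poly_Mapping.lookup x i"
proof -
  have "finite {i. c *\<^sub>R Poly_Mapping.lookup x i \<noteq> 0}"
    by (rule finite_subset[OF _ finite_keys[of x]]) (auto simp: in_keys_iff)
  then show ?thesis
    by (simp add: scaleR_poly_mapping_def Abs_poly_mapping_inverse)
qed

lemma Rd_scaleR [simp]: "x \<in> Rd d \<Longrightarrow> c *\<^sub>R x \<in> Rd d"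
  by (auto simp: Rd_def)

lemma segment_point_Rd [simp]: "x \<in> Rd d \<Longrightarrow> y \<in> Rd d \<Longrightarrow> segment_point x y l \<in> Rd d"
  by (simp add: segment_point_def)

lemma ip_add: "ip d x (y + z) = ip d x y + ip d x z"
  and ip_diff: "ip d x (y - z) = ip d x y - ip d x z"
  and ip_scaleR: "ip d x (c *\<^sub>R y) = c * ip d x y"
  and ip_minus: "ip d x (- y) = - ip d x y"
  and ip_zero: "ip d x 0 = 0"
  by (simp_all add: ip_def lookup_add lookup_minus sum.distrib algebra_simps
      sum_subtractf sum_distrib_left sum_negf)

lemmas ip_linear = ip_add ip_diff ip_scaleR ip_minus ip_zero

text \<open>
  All the calculus on \<open>\<real>\<^sup>d\<close> goes through restrictions to lines, which turn the derivative within
  \<open>Rd d\<close> into an ordinary derivative on the reals.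
\<close>

lemma line_derivative:
  assumes "C1_with_gradient d G gG" "y \<in> Rd d" "v \<in> Rd d"
  shows "((\<lambda>s. G (y + s *\<^sub>R v)) has_real_derivative ip d (gG (y + s *\<^sub>R v)) v) (at s)"
proof -
  have "((\<lambda>s. G (y + s *\<^sub>R v)) has_derivative (\<lambda>h. ip d (gG (y + s *\<^sub>R v)) (h *\<^sub>R v))) (at s)"
  proof (rule has_derivative_in_compose2[where t = "Rd d" and f = "\<lambda>s. y + s *\<^sub>R v"])
    show "(G has_derivative ip d (gG x)) (at x within Rd d)" if "x \<in> Rd d" for x
      using assms(1) that by (simp add: C1_with_gradient_def)
    show "((\<lambda>s. y + s *\<^sub>R v) has_derivative (\<lambda>h. h *\<^sub>R v)) (at s)"
      by (auto intro!: derivative_eq_intros)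
  qed (use assms in auto)
  moreover have "(\<lambda>h. ip d (gG (y + s *\<^sub>R v)) (h *\<^sub>R v)) = (*) (ip d (gG (y + s *\<^sub>R v)) v)"
    by (simp add: fun_eq_iff ip_scaleR)
  ultimately show ?thesis
    by (simp add: has_field_derivative_def)
qed

lemma gradient_vanishes_at_minimum:
  assumes "C1_with_gradient d G gG" "is_arg_min G (\<lambda>y. y \<in> Rd d) z" "v \<in> Rd d"
  shows "ip d (gG z) v = 0"
proof -
  have "z \<in> Rd d" and min: "\<And>y. y \<in> Rd d \<Longrightarrow> G z \<le> G y"
    using assms(2) by (auto simp: is_arg_min_def not_less)
  have "((\<lambda>s. G (z + s *\<^sub>R v)) has_real_derivative ip d (gG (z + 0 *\<^sub>R v)) v) (at 0)"
    by (rule line_derivative) (use assms \<open>z \<in> Rd d\<close> in auto)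
  then have "ip d (gG (z + 0 *\<^sub>R v)) v = 0"
    by (rule DERIV_local_min[where d = 1]) (use min assms(3) \<open>z \<in> Rd d\<close> in auto)
  then show ?thesis
    by simp
qed

lemma bregman_arg_min_optimality:
  assumes psi: "C1_with_gradient d \<psi> g\<psi>" and "x \<in> Rd d"
    and min: "is_arg_min (\<lambda>y. \<eta> * ip d w y + bregman d \<psi> g\<psi> y x) (\<lambda>y. y \<in> Rd d) x'"
    and "v \<in> Rd d"
  shows "\<eta> * ip d w v = ip d (g\<psi> x) v - ip d (g\<psi> x') v"
proof -
  have x': "x' \<in> Rd d" and x'_min: "\<And>y. y \<in> Rd d \<Longrightarrow>
      \<eta> * ip d w x' + bregman d \<psi> g\<psi> x' x \<le> \<eta> * ip d w y + bregman d \<psi> g\<psi> y x"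
    using min by (auto simp: is_arg_min_def not_less)
  define h where "h = (\<lambda>s. \<eta> * ip d w (x' + s *\<^sub>R v) + bregman d \<psi> g\<psi> (x' + s *\<^sub>R v) x)"
  have "((\<lambda>s. \<psi> (x' + s *\<^sub>R v)) has_real_derivative ip d (g\<psi> (x' + 0 *\<^sub>R v)) v) (at 0)"
    by (rule line_derivative) (use assms x' in auto)
  then have "(h has_real_derivative \<eta> * ip d w v + (ip d (g\<psi> x') v - ip d (g\<psi> x) v)) (at 0)"
    unfolding h_def bregman_def ip_linear by (auto intro!: derivative_eq_intros)
  then have "\<eta> * ip d w v + (ip d (g\<psi> x') v - ip d (g\<psi> x) v) = 0"
    by (rule DERIV_local_min[where d = 1]) (use x'_min x' \<open>v \<in> Rd d\<close> in \<open>auto simp: h_def\<close>)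
  then show ?thesis
    by simp
qed

section \<open>One iteration\<close>

text \<open>
  The price of the mismatch between the smoothness exponent \<open>\<kappa>\<close> of the objective and the convexity
  exponent \<open>q\<close> of the regularizer: the maximum of the left-hand side over \<open>s\<close>, obtained from
  Young's inequality with exponents \<open>q / \<kappa>\<close> and \<open>q / (q - \<kappa>)\<close>.
\<close>

lemma powr_difference_le:
  fixes s :: real
  assumes "0 < \<kappa>" "\<kappa> < q" "0 < c" "0 < \<mu>" "0 \<le> s"
  shows "c / \<kappa> * s powr \<kappa> - \<mu> / q * s powr q
    \<le> (q - \<kappa>) / (\<kappa> * q) * (c powr (q / (q - \<kappa>)) / \<mu> powr (\<kappa> / (q - \<kappa>)))"
proof -
  define a where "a = c / \<mu> powr (\<kappa> / q)"
  define b where "b = \<mu> powr (\<kappa> / q) * s powr \<kappa>"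
  have "a * b \<le> a powr (q / (q - \<kappa>)) / (q / (q - \<kappa>)) + b powr (q / \<kappa>) / (q / \<kappa>)"
    using assms by (intro Youngs_inequality) (auto simp: a_def b_def field_simps)
  moreover have "a * b = c * s powr \<kappa>"
    using assms by (simp add: a_def b_def)
  moreover have "a powr (q / (q - \<kappa>)) = c powr (q / (q - \<kappa>)) / \<mu> powr (\<kappa> / (q - \<kappa>))"
    using assms by (simp add: a_def powr_divide powr_powr)
  moreover have "b powr (q / \<kappa>) = \<mu> * s powr q"
    using assms by (simp add: b_def powr_mult powr_powr)
  ultimately have "c * s powr \<kappa> \<le> (c powr (q / (q - \<kappa>)) / \<mu> powr (\<kappa> / (q - \<kappa>))) * ((q - \<kappa>) / q)
      + \<mu> * s powr q * (\<kappa> / q)"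
    by simp
  then have "(c * s powr \<kappa>) / \<kappa> \<le> ((c powr (q / (q - \<kappa>)) / \<mu> powr (\<kappa> / (q - \<kappa>))) * ((q - \<kappa>) / q)
      + \<mu> * s powr q * (\<kappa> / q)) / \<kappa>"
    using assms by (intro divide_right_mono) auto
  then show ?thesis
    using assms by (simp add: add_divide_distrib algebra_simps)
qed

locale amd_problem =
  fixes d :: nat and N F :: "vec \<Rightarrow> real" and gF :: "vec \<Rightarrow> vec"
    and \<psi> :: "vec \<Rightarrow> real" and g\<psi> :: "vec \<Rightarrow> vec" and q \<kappa> \<tau> L \<mu> :: real and xs :: vec
  assumes standing: "standing_assumption d N F gF \<psi> g\<psi> q \<kappa> \<tau> L \<mu> xs"
    and kappa_less_q: "\<kappa> < q"
begin

lemma parameter_ranges: "2 \<le> q" "1 < \<kappa>" "\<kappa> \<le> 2" "0 < \<tau>" "0 < L" "0 < \<mu>" "\<kappa> < q"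
  using standing kappa_less_q by (auto simp: standing_assumption_def)

lemma C1: "C1_with_gradient d F gF" "C1_with_gradient d \<psi> g\<psi>"
  using standing by (auto simp: standing_assumption_def)

lemma norm_nonneg: "x \<in> Rd d \<Longrightarrow> 0 \<le> N x"
  and norm_scaleR: "x \<in> Rd d \<Longrightarrow> N (c *\<^sub>R x) = \<bar>c\<bar> * N x"
  and norm_triangle: "x \<in> Rd d \<Longrightarrow> y \<in> Rd d \<Longrightarrow> N (x + y) \<le> N x + N y"
  using standing by (auto simp: standing_assumption_def norm_on_Rd_def)

lemma norm_minus_commute: "x \<in> Rd d \<Longrightarrow> y \<in> Rd d \<Longrightarrow> N (x - y) = N (y - x)"
  using norm_scaleR[of "y - x" "-1"] by simp

lemma xs_min: "is_arg_min F (\<lambda>x. x \<in> Rd d) xs"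
  using standing by (auto simp: standing_assumption_def star_convex_at_def)

lemma xs_Rd [simp]: "xs \<in> Rd d"
  using xs_min by (simp add: is_arg_min_def)

lemma F_ge: "x \<in> Rd d \<Longrightarrow> F xs \<le> F x"
  using xs_min by (auto simp: is_arg_min_def not_less)

lemma star_convex: "x \<in> Rd d \<Longrightarrow> F x - F xs \<le> \<tau> * ip d (gF x) (x - xs)"
  using standing by (auto simp: standing_assumption_def star_convex_at_def)

lemma smooth: "x \<in> Rd d \<Longrightarrow> y \<in> Rd d \<Longrightarrow> 
    \<bar>F x - F y - ip d (gF y) (x - y)\<bar> \<le> L / \<kappa> * N (x - y) powr \<kappa>"
  using standing by (auto simp: standing_assumption_def weakly_smooth_def bregman_def)

lemma bregman_ge: "x \<in> Rd d \<Longrightarrow> y \<in> Rd d \<Longrightarrow> \<mu> / q * N (x - y) powr q \<le> bregman d \<psi> g\<psi> x y"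
  using standing by (auto simp: standing_assumption_def uniformly_convex_def)

lemma bregman_nonneg: "x \<in> Rd d \<Longrightarrow> y \<in> Rd d \<Longrightarrow> 0 \<le> bregman d \<psi> g\<psi> x y"
  using bregman_ge[of x y] parameter_ranges by (smt (verit) divide_nonneg_nonneg mult_nonneg_nonneg powr_ge_zero)

lemma gap_le: 
  assumes "x \<in> Rd d" shows "F x - F xs \<le> L / \<kappa> * N (x - xs) powr \<kappa>"
  using smooth[OF assms xs_Rd] gradient_vanishes_at_minimum[OF C1(1) xs_min, of "x - xs"] assms by simp

lemma segment_gap_derivative:
  assumes "x \<in> Rd d" "y \<in> Rd d"
  shows "(segment_gap F x y has_real_derivative ip d (gF (segment_point x y l)) (y - x)) (at l)"
proof -
  have "segment_point x y l = x + l *\<^sub>R (y - x)" for l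
    by (simp add: segment_point_def algebra_simps)
  then show ?thesis
    using line_derivative[OF C1(1), of x "y - x" l] assms
    unfolding segment_gap_def by (auto intro!: derivative_eq_intros)
qed

lemma segment_gap_hoelder:
  assumes "x \<in> Rd d" "y \<in> Rd d"
  shows "\<bar>segment_gap F x y s - segment_gap F x y t - ip d (gF (segment_point x y t)) (y - x) * (s - t)\<bar>
    \<le> L / \<kappa> * N (y - x) powr \<kappa> * \<bar>s - t\<bar> powr \<kappa>"
proof -
  have "segment_point x y s - segment_point x y t = (s - t) *\<^sub>R (y - x)"
    by (simp add: segment_point_def algebra_simps)
  then show ?thesis
    using smooth[of "segment_point x y s" "segment_point x y t"] assms
    by (simp add: segment_gap_def ip_scaleR norm_scaleR norm_nonneg powr_mult mult_ac)
qed

lemma segment_gap_1: "segment_gap F x y 1 = 0"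
  by (simp add: segment_gap_def segment_point_def)

lemma prox_optimality:
  assumes "is_arg_min (\<lambda>y. \<alpha> * ip d w y + \<mu> / q * N (y - z) powr q) (\<lambda>y. y \<in> Rd d) y"
    and "z \<in> Rd d" "v \<in> Rd d"
  shows "\<alpha> * ip d w (y - z) + \<mu> / q * N (y - z) powr q \<le> \<alpha> * ip d w v + \<mu> / q * N v powr q"
proof -
  have "z + v \<in> Rd d"
    using assms by simp
  then have "\<alpha> * ip d w y + \<mu> / q * N (y - z) powr q
      \<le> \<alpha> * ip d w (z + v) + \<mu> / q * N (z + v - z) powr q"
    using assms(1) unfolding is_arg_min_def not_ex de_Morgan_conj not_less by blast
  then show ?thesis
    by (simp add: ip_linear algebra_simps)
qed

text \<open>
  The energy inequality of one iteration. The mirror step is an exact three-point identity and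
  leaves the term \<open>\<eta> * \<langle>\<nabla>F, x - x'\<rangle>\<close>. The step that defines \<open>xag'\<close> pays for it: comparing its
  minimizer with the displacement \<open>- (x - x') / \<theta>\<close> gives exactly the right multiples of both the
  linear and the \<open>q\<close>-th power term, so that dual norms and conjugate functions are not involved.
  The relation \<open>C = \<theta> - 1 / \<tau>\<close> makes the values of \<open>F\<close> at the search point cancel.
\<close>

lemma iteration_inequality:
  assumes it: "amd_iteration d N F gF \<psi> g\<psi> q \<mu> C \<epsilon> \<alpha> \<eta> x xag x' xag' n"
    and xs_in: "x \<in> Rd d" "xag \<in> Rd d" and "0 < \<alpha>" "0 < \<theta>"
    and eta: "\<eta> = \<alpha> * \<theta> powr (q - 1)" and C: "C = \<theta> - 1 / \<tau>"
  shows "\<eta> * \<theta> * (F xag' - F xs) + bregman d \<psi> g\<psi> xs x'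
    \<le> (\<eta> * \<theta> - \<eta> / \<tau>) * (F xag - F xs) + bregman d \<psi> g\<psi> xs x + \<eta> * \<epsilon>
      + \<theta> powr q * ((q - \<kappa>) / (\<kappa> * q) *
          ((\<alpha> * L) powr (q / (q - \<kappa>)) / \<mu> powr (\<kappa> / (q - \<kappa>))))"
proof -
  obtain l m where bs: "binary_search (segment_gap F x xag) C \<epsilon> l m"
    and mirror: "is_arg_min (\<lambda>y. \<eta> * ip d (gF (segment_point x xag l)) y + bregman d \<psi> g\<psi> y x)
      (\<lambda>y. y \<in> Rd d) x'"
    and prox: "is_arg_min (\<lambda>y. \<alpha> * ip d (gF (segment_point x xag l)) y
      + \<mu> / q * N (y - segment_point x xag l) powr q) (\<lambda>y. y \<in> Rd d) xag'"
    using it by (auto simp: amd_iteration_def Let_def)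
  define z where "z = segment_point x xag l"
  define G where "G = ip d (gF z)"
  define w where "w = x - x'"
  define p where "p = xag' - z"
  have z [simp]: "z \<in> Rd d"
    by (simp add: z_def xs_in)
  have x' [simp]: "x' \<in> Rd d" and xag' [simp]: "xag' \<in> Rd d"
    using mirror prox by (auto simp: is_arg_min_def)
  have w: "w \<in> Rd d" and p: "p \<in> Rd d"
    using xs_in by (auto simp: w_def p_def)
  note r = parameter_ranges
  have "0 < \<eta>"
    using assms by simp
  have G_add: "G (u + v) = G u + G v" for u v
    by (simp add: G_def ip_linear)
  \<comment> \<open>The one-dimensional stopping test of the search, read as a statement about gradients.\<close>
  have search: "G (z - x) + C * (F z - F xag) \<le> \<epsilon>"
  proof -
    have "z - x = l *\<^sub>R (xag - x)"
      by (simp add: z_def segment_point_def algebra_simps)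
    moreover have "l * ip d (gF z) (xag - x) + C * segment_gap F x xag l \<le> \<epsilon>"
      using binary_search_condition[OF bs segment_gap_1]
      unfolding DERIV_imp_deriv[OF segment_gap_derivative[OF xs_in]] z_def by blast
    ultimately show ?thesis
      by (simp add: G_def z_def segment_gap_def ip_scaleR)
  qed
  have star: "\<eta> / \<tau> * (F z - F xs) \<le> \<eta> * G (z - xs)"
  proof -
    have "(F z - F xs) / \<tau> \<le> G (z - xs)"
      using star_convex[of z] r by (simp add: G_def field_simps)
    then show ?thesis
      using mult_left_mono[of _ _ \<eta>] \<open>0 < \<eta>\<close> by fastforce
  qed
  have mirror': "\<eta> * G (x' - xs) + \<mu> / q * N w powr q
      \<le> bregman d \<psi> g\<psi> xs x - bregman d \<psi> g\<psi> xs x'"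
  proof -
    have "\<eta> * G (x' - xs) = ip d (g\<psi> x) (x' - xs) - ip d (g\<psi> x') (x' - xs)"
      unfolding G_def z_def
      by (rule bregman_arg_min_optimality[OF C1(2) _ mirror]) (use xs_in in auto)
    moreover have "\<mu> / q * N w powr q \<le> bregman d \<psi> g\<psi> x' x"
      using bregman_ge[of x' x] xs_in norm_minus_commute[of x x'] by (simp add: w_def)
    ultimately show ?thesis
      by (simp add: bregman_def ip_linear algebra_simps)
  qed
  have pow: "\<alpha> * \<theta> powr q = \<eta> * \<theta>"
    using \<open>0 < \<theta>\<close> by (simp add: eta powr_diff)
  have prox': "\<eta> * \<theta> * G p + \<theta> powr q * (\<mu> / q * N p powr q) \<le> - (\<eta> * G w) + \<mu> / q * N w powr q"
  proof -
    have "\<alpha> * G p + \<mu> / q * N p powr q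
        \<le> \<alpha> * G ((- (1 / \<theta>)) *\<^sub>R w) + \<mu> / q * N ((- (1 / \<theta>)) *\<^sub>R w) powr q"
      using prox_optimality[OF prox, of "(- (1 / \<theta>)) *\<^sub>R w"] w xs_in
      by (simp add: p_def z_def G_def)
    also have "\<dots> = - (\<alpha> / \<theta>) * G w + \<mu> / q * N w powr q / \<theta> powr q"
      using w \<open>0 < \<theta>\<close> norm_scaleR[OF w, of "- (1 / \<theta>)"]
      by (simp add: G_def ip_scaleR norm_nonneg powr_divide powr_mult ip_linear)
    finally have "\<theta> powr q * (\<alpha> * G p + \<mu> / q * N p powr q)
        \<le> \<theta> powr q * (- (\<alpha> / \<theta>) * G w + \<mu> / q * N w powr q / \<theta> powr q)"
      by (rule mult_left_mono) simp
    also have "\<dots> = - (\<eta> * G w) + \<mu> / q * N w powr q"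
    proof -
      have "\<eta> = \<theta> powr q * (\<alpha> / \<theta>)"
        using pow \<open>0 < \<theta>\<close> by (simp add: field_simps)
      then show ?thesis
        using \<open>0 < \<theta>\<close> by (simp add: algebra_simps)
    qed
    finally show ?thesis
      unfolding pow[symmetric] by (simp add: algebra_simps)
  qed
  have descent: "\<eta> * \<theta> * (F xag' - F z) \<le> \<eta> * \<theta> * G p + \<eta> * \<theta> * (L / \<kappa> * N p powr \<kappa>)"
  proof -
    have "F xag' - F z \<le> G p + L / \<kappa> * N p powr \<kappa>"
      using smooth[of xag' z] by (simp add: p_def G_def)
    then have "\<eta> * \<theta> * (F xag' - F z) \<le> \<eta> * \<theta> * (G p + L / \<kappa> * N p powr \<kappa>)"
      using \<open>0 < \<eta>\<close> \<open>0 < \<theta>\<close> by (intro mult_left_mono) auto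
    then show ?thesis
      by (simp add: algebra_simps)
  qed
  define E where "E = (q - \<kappa>) / (\<kappa> * q) * ((\<alpha> * L) powr (q / (q - \<kappa>)) / \<mu> powr (\<kappa> / (q - \<kappa>)))"
  have error: "\<eta> * \<theta> * (L / \<kappa> * N p powr \<kappa>) - \<theta> powr q * (\<mu> / q * N p powr q) \<le> \<theta> powr q * E"
  proof -
    have "\<alpha> * L / \<kappa> * N p powr \<kappa> - \<mu> / q * N p powr q \<le> E"
      unfolding E_def using r \<open>0 < \<alpha>\<close> norm_nonneg[OF p] by (intro powr_difference_le) auto
    then have "\<theta> powr q * (\<alpha> * L / \<kappa> * N p powr \<kappa> - \<mu> / q * N p powr q) \<le> \<theta> powr q * E"
      by (rule mult_left_mono) simp
    then show ?thesis
      unfolding pow[symmetric] by (simp add: algebra_simps)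
  qed
  have "\<eta> * (G (z - x) + C * (F z - F xag)) \<le> \<eta> * \<epsilon>"
    using search \<open>0 < \<eta>\<close> by (intro mult_left_mono) auto
  then have "\<eta> * G (z - x) + (\<eta> * \<theta> - \<eta> / \<tau>) * (F z - F xag) \<le> \<eta> * \<epsilon>"
    unfolding C by (simp add: algebra_simps)
  moreover have "\<eta> * G (z - xs) = \<eta> * G (z - x) + \<eta> * G w + \<eta> * G (x' - xs)"
    using G_add[of "z - x" "x - xs"] G_add[of w "x' - xs"] by (simp add: w_def algebra_simps)
  ultimately have "\<eta> / \<tau> * (F z - F xs) + (\<eta> * \<theta> - \<eta> / \<tau>) * (F z - F xag) + \<eta> * \<theta> * (F xag' - F z)
      \<le> \<eta> * \<epsilon> + bregman d \<psi> g\<psi> xs x - bregman d \<psi> g\<psi> xs x' + \<theta> powr q * E"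
    using star mirror' prox' descent error by (simp add: algebra_simps)
  then show ?thesis
    unfolding E_def[symmetric] by (simp add: algebra_simps)
qed

text \<open>
  The step from the search point to \<open>xag'\<close> has length \<open>y\<close> with \<open>y\<^sup>q\<close> of order \<open>R\<^sup>\<kappa> + y\<^sup>\<kappa>\<close>, where
  \<open>R\<close> is the distance of the iterates from the minimizer. Since \<open>\<kappa> < q\<close>, distances can only grow
  sublinearly in themselves per step, hence polynomially overall.
\<close>

lemma iteration_ag_step:
  assumes it: "amd_iteration d N F gF \<psi> g\<psi> q \<mu> C \<epsilon> \<alpha> \<eta> x xag x' xag' n"
    and xs_in: "x \<in> Rd d" "xag \<in> Rd d" and "0 < \<alpha>"
    and R: "N (x - xs) \<le> R" "N (xag - xs) \<le> R"
  obtains y where "0 \<le> y" "N (xag' - xs) \<le> R + y"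
    "y powr q \<le> \<alpha> * L * q / (\<kappa> * \<mu>) * (R powr \<kappa> + y powr \<kappa>)"
proof -
  obtain l m where bs: "binary_search (segment_gap F x xag) C \<epsilon> l m"
    and prox: "is_arg_min (\<lambda>y. \<alpha> * ip d (gF (segment_point x xag l)) y
      + \<mu> / q * N (y - segment_point x xag l) powr q) (\<lambda>y. y \<in> Rd d) xag'"
    using it by (auto simp: amd_iteration_def Let_def)
  have l: "0 \<le> l" "l \<le> 1"
    using binary_search_condition[OF bs segment_gap_1] by auto
  define z where "z = segment_point x xag l"
  define p where "p = xag' - z"
  note r = parameter_ranges
  have z [simp]: "z \<in> Rd d"
    by (simp add: z_def xs_in)
  have xag' [simp]: "xag' \<in> Rd d"
    using prox by (auto simp: is_arg_min_def)
  have p [simp]: "p \<in> Rd d"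
    by (simp add: p_def)
  have "z - xs = l *\<^sub>R (xag - xs) + (1 - l) *\<^sub>R (x - xs)"
    by (simp add: z_def segment_point_def algebra_simps)
  then have "N (z - xs) \<le> l * N (xag - xs) + (1 - l) * N (x - xs)"
    using norm_triangle[of "l *\<^sub>R (xag - xs)" "(1 - l) *\<^sub>R (x - xs)"] xs_in l
    by (simp add: norm_scaleR)
  also have "\<dots> \<le> l * R + (1 - l) * R"
    using R l by (intro add_mono mult_left_mono) auto
  finally have zR: "N (z - xs) \<le> R"
    by (simp add: algebra_simps)
  have "N (xag' - xs) \<le> N (z - xs) + N p"
    using norm_triangle[of "z - xs" p] by (simp add: p_def)
  then have 1: "N (xag' - xs) \<le> R + N p"
    using zR by linarith
  have "- ip d (gF z) p \<le> L / \<kappa> * N (z - xs) powr \<kappa> + L / \<kappa> * N p powr \<kappa>"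
    using smooth[of xag' z] F_ge[of xag'] gap_le[of z] by (simp add: p_def)
  also have "\<dots> \<le> L / \<kappa> * R powr \<kappa> + L / \<kappa> * N p powr \<kappa>"
    using r zR norm_nonneg[of "z - xs"] norm_nonneg[OF p] by (intro add_mono mult_left_mono powr_mono2) auto
  finally have "\<alpha> * - ip d (gF z) p \<le> \<alpha> * (L / \<kappa> * R powr \<kappa> + L / \<kappa> * N p powr \<kappa>)"
    using \<open>0 < \<alpha>\<close> by (intro mult_left_mono) auto
  moreover have "N 0 = 0"
    using norm_scaleR[of 0 0] by simp
  then have "\<alpha> * ip d (gF z) p + \<mu> / q * N p powr q \<le> 0"
    using prox_optimality[OF prox, of 0] xs_in by (simp add: p_def z_def ip_zero)
  ultimately have "\<mu> / q * N p powr q \<le> \<alpha> * (L / \<kappa> * R powr \<kappa> + L / \<kappa> * N p powr \<kappa>)"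
    by linarith
  then have "N p powr q \<le> \<alpha> * L * q / (\<kappa> * \<mu>) * (R powr \<kappa> + N p powr \<kappa>)"
    using r by (simp add: field_simps)
  then show thesis
    using that[of "N p"] 1 norm_nonneg[of p] by simp
qed

end

section \<open>The parameters\<close>

text \<open>
  Without the exponential weights the inequality is Bernoulli's when \<open>P \<ge> 1\<close>, but for \<open>P < 1\<close> it
  fails by a factor \<open>1 + O(1 / n\<^sup>2)\<close>. The product of these factors over all \<open>n\<close> converges; the
  weight \<open>exp (2 * P / n)\<close> absorbs it by telescoping, because \<open>1 / n\<^sup>2 \<le> 1 / (n - 1) - 1 / n\<close>.
\<close>

lemma weight_decrease:
  fixes P n :: real
  assumes "0 < P" "2 \<le> n"
  shows "exp (2 * P / n) * (n powr P - P * n powr (P - 1)) \<le> exp (2 * P / (n - 1)) * (n - 1) powr P"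
proof -
  define u where "u = 1 / n"
  have u: "0 < u" "u \<le> 1 / 2"
    using assms by (auto simp: u_def field_simps)
  have "2 * P / n + 2 * P * u\<^sup>2 \<le> 2 * P / (n - 1)"
  proof -
    have "u + u\<^sup>2 \<le> 1 / (n - 1)"
      using assms by (simp add: u_def field_simps power2_eq_square)
    then show ?thesis
      using mult_left_mono[of "u + u\<^sup>2" "1 / (n - 1)" "2 * P"] assms
      by (simp add: u_def algebra_simps)
  qed
  moreover have "P * (- u - 2 * u\<^sup>2) \<le> P * ln (1 - u)"
    using u assms by (intro mult_left_mono ln_one_minus_pos_lower_bound) auto
  ultimately have *: "2 * P / n - P * u \<le> 2 * P / (n - 1) + P * ln (1 - u)"
    by (simp add: algebra_simps)
  have "exp (2 * P / n) * (1 - P * u) \<le> exp (2 * P / n) * exp (- (P * u))"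
    using exp_ge_add_one_self[of "- (P * u)"] by (intro mult_left_mono) auto
  also have "\<dots> \<le> exp (2 * P / (n - 1)) * exp (P * ln (1 - u))"
    using * by (simp flip: exp_add)
  also have "exp (P * ln (1 - u)) = (1 - u) powr P"
    using u by (simp add: powr_def)
  finally have "n powr P * (exp (2 * P / n) * (1 - P * u))
      \<le> n powr P * (exp (2 * P / (n - 1)) * (1 - u) powr P)"
    by (rule mult_left_mono) simp
  moreover have "n powr P * (1 - u) powr P = (n - 1) powr P"
  proof -
    have "n powr P * (1 - u) powr P = (n * (1 - u)) powr P"
      using u assms by (simp add: powr_mult)
    also have "n * (1 - u) = n - 1"
      using assms by (simp add: u_def field_simps)
    finally show ?thesis .
  qed
  moreover have "n powr P * (1 - P * u) = n powr P - P * n powr (P - 1)"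
    using assms by (simp add: u_def powr_diff algebra_simps)
  ultimately show ?thesis
    by (metis mult.left_commute)
qed

locale tuned_amd = amd_problem +
  fixes B :: real and x1 :: vec
  assumes B_pos: "0 < B" and x1_Rd: "x1 \<in> Rd d" and bregman_x1: "1 / \<mu> * bregman d \<psi> g\<psi> xs x1 \<le> B"
begin

text \<open>
  \<open>P\<close> is the exponent of the convergence rate. \<open>W\<close> and \<open>err\<close> are the constants for which the
  weight \<open>\<eta> t * \<theta> t\<close> of the gap in the energy inequality is \<open>W * t\<^sup>P\<close> and each of its two error
  terms is \<open>err / t\<close>, where \<open>\<theta> t = t / (\<tau> * P)\<close>.
\<close>

definition P :: real where "P = q - beta_par q \<kappa>"
definition W :: real where "W = alpha_par q \<kappa> L \<mu> B / (\<tau> * P) powr \<kappa>"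
definition err :: real where "err = \<mu> * ((q - \<kappa>) / \<kappa> * B) * ((q - \<kappa>) / (\<kappa> * q))"

abbreviation "run \<equiv> tuned_run d N F gF \<psi> g\<psi> q \<kappa> \<tau> L \<mu> B x1"
abbreviation "al \<equiv> alpha_seq q \<kappa> \<tau> L \<mu> B"
abbreviation "et \<equiv> eta_seq q \<kappa> \<tau> L \<mu> B"
abbreviation "Cs \<equiv> C_seq q \<kappa> \<tau> L \<mu> B"
abbreviation "ep \<equiv> eps_seq q \<kappa> \<tau> L \<mu> B"
abbreviation "D \<equiv> bregman d \<psi> g\<psi> xs"
abbreviation "al0 \<equiv> alpha_par q \<kappa> L \<mu> B"

lemma P_eq: "P = \<kappa> - 1 + \<kappa> / q"
  using parameter_ranges by (simp add: P_def beta_par_def field_simps)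

lemma P_pos: "0 < P" and P_less_2: "P < 2"
proof -
  have "0 < \<kappa> / q" "\<kappa> / q < 1"
    using parameter_ranges by auto
  then show "0 < P" "P < 2"
    using parameter_ranges unfolding P_eq by linarith+
qed

lemma beta_pos: "0 < beta_par q \<kappa>"
  using parameter_ranges by (simp add: beta_par_def add_pos_pos)

lemma al0_pos: "0 < al0"
  using parameter_ranges B_pos by (simp add: alpha_par_def)

lemma W_pos: "0 < W"
  using parameter_ranges P_pos al0_pos by (simp add: W_def)

lemma err_pos: "0 < err"
  using parameter_ranges B_pos by (simp add: err_def)

lemma al_eq: "al t = (\<tau> * P) powr (q - \<kappa>) * (al0 / real t powr beta_par q \<kappa>)"
  by (simp add: alpha_seq_def P_def)

lemma et_eq: "et t = al t * (real t / (\<tau> * P)) powr (q - 1)"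
  by (simp add: eta_seq_def P_def)

lemma al_pos: "1 \<le> t \<Longrightarrow> 0 < al t"
  using parameter_ranges P_pos al0_pos by (simp add: al_eq)

lemma tau_P_simps [simp]: "0 < \<tau>" "0 < P" "0 < \<tau> * P" "\<tau> \<noteq> 0" "P \<noteq> 0"
    "\<bar>\<tau> * P\<bar> = \<tau> * P" "0 \<le> \<tau> * P" "0 \<le> P" "0 \<le> \<tau>"
  using parameter_ranges P_pos by (auto simp: abs_mult)

lemma theta_pos: "1 \<le> t \<Longrightarrow> 0 < real t / (\<tau> * P)"
  using parameter_ranges P_pos by simp

lemma et_pos: "1 \<le> t \<Longrightarrow> 0 < et t"
  unfolding et_eq using al_pos by (intro mult_pos_pos) auto

lemma al_le: "1 \<le> t \<Longrightarrow> al t \<le> al 1"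
  unfolding al_eq using beta_pos al0_pos ge_one_powr_ge_zero[of "real t" "beta_par q \<kappa>"]
  by (intro mult_left_mono divide_left_mono) auto

lemma Cs_eq:
  assumes "1 \<le> t" shows "Cs t = real t / (\<tau> * P) - 1 / \<tau>"
proof -
  have "et t / al t = (real t / (\<tau> * P)) powr (q - 1)"
    using al_pos[OF assms] by (simp add: et_eq)
  moreover have "(q - 1) * (q / (q - 1) - 1) = 1"
    using parameter_ranges by (simp add: field_simps)
  ultimately show ?thesis
    using theta_pos[OF assms] by (simp add: C_seq_def powr_powr)
qed

text \<open>
  \<open>C\<^sub>1\<close> is negative when \<open>P > 1\<close>; the first search is trivial for another reason, namely that both
  of its endpoints are the starting point.
\<close>

lemma Cs_nonneg: "2 \<le> t \<Longrightarrow> 0 \<le> Cs t"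
proof -
  assume "2 \<le> t"
  moreover have "real t / (\<tau> * P) - 1 / \<tau> = (real t - P) / (\<tau> * P)"
    using P_pos by (simp add: diff_divide_distrib)
  ultimately show "0 \<le> Cs t"
    using Cs_eq[of t] P_less_2 less_imp_le[OF tau_P_simps(3)] by simp
qed

lemma et_theta:
  assumes "1 \<le> t" shows "et t * (real t / (\<tau> * P)) = W * real t powr P"
proof -
  have "et t * (real t / (\<tau> * P)) = al t * (real t / (\<tau> * P)) powr q"
    using theta_pos[OF assms] by (simp add: et_eq powr_diff)
  also have "\<dots> = al0 / (\<tau> * P) powr \<kappa> * (real t powr q / real t powr beta_par q \<kappa>)"
    using parameter_ranges P_pos by (simp add: al_eq powr_divide powr_diff)
  also have "\<dots> = W * real t powr P"
    using assms by (simp add: W_def P_def powr_diff)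
  finally show ?thesis .
qed

lemma et_eq': 
  assumes "1 \<le> t" shows "et t = \<tau> * (W * P * real t powr (P - 1))"
proof -
  have "et t = et t * (real t / (\<tau> * P)) * (\<tau> * P / real t)"
    using assms parameter_ranges P_pos by simp
  then show ?thesis
    unfolding et_theta[OF assms] using assms by (simp add: powr_diff)
qed

lemma al0_power: "(al0 * L) powr (q / (q - \<kappa>)) / \<mu> powr (\<kappa> / (q - \<kappa>)) = \<mu> * ((q - \<kappa>) / \<kappa> * B)"
proof -
  have "(al0 * L) powr (q / (q - \<kappa>)) = \<mu> powr (q / (q - \<kappa>)) * ((q - \<kappa>) / \<kappa> * B)"
    using parameter_ranges B_pos by (simp add: alpha_par_def powr_mult powr_powr)
  moreover have "\<mu> powr (q / (q - \<kappa>)) / \<mu> powr (\<kappa> / (q - \<kappa>)) = \<mu>"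
  proof -
    have "q / (q - \<kappa>) - \<kappa> / (q - \<kappa>) = 1"
      using parameter_ranges by (simp flip: diff_divide_distrib)
    then show ?thesis
      using parameter_ranges by (simp flip: powr_diff)
  qed
  ultimately show ?thesis
    by (metis times_divide_eq_left)
qed

lemma et_ep:
  assumes "1 \<le> t" shows "et t * ep t = err / real t"
proof -
  note r = parameter_ranges
  have M: "M_par q \<kappa> powr (1 / r_par q \<kappa>) = (q - \<kappa>) / (\<kappa> * q)"
    using r by (simp add: M_par_def r_par_def powr_powr)
  have inv: "1 / r_par q \<kappa> = \<kappa> / (q - \<kappa>)"
    by (simp add: r_par_def)
  have inv': "1 + 1 / r_par q \<kappa> = q / (q - \<kappa>)"
    using r by (simp add: r_par_def field_simps)
  have "et t * ep t = al0 powr (q / (q - \<kappa>)) / real t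
      * ((q - \<kappa>) / (\<kappa> * q) / \<mu> powr (\<kappa> / (q - \<kappa>))) * L powr (q / (q - \<kappa>))"
    unfolding eps_seq_def inv' M unfolding inv using et_pos[OF assms] by simp
  also have "\<dots> = (al0 * L) powr (q / (q - \<kappa>)) / \<mu> powr (\<kappa> / (q - \<kappa>)) * ((q - \<kappa>) / (\<kappa> * q)) / real t"
    using al0_pos r by (simp add: powr_mult mult_ac)
  finally show ?thesis
    by (simp only: al0_power err_def)
qed

lemma ep_pos: "1 \<le> t \<Longrightarrow> 0 < ep t"
  using et_ep[of t] et_pos[of t] err_pos
  by (metis divide_pos_pos not_less of_nat_0_less_iff zero_less_mult_pos less_le_trans zero_less_one)

text \<open>
  The exponent \<open>beta_par q \<kappa>\<close> is chosen for this identity: it solves \<open>\<beta> * q / (q - \<kappa>) = q + 1\<close>,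
  which makes the Young error decay exactly like \<open>1 / t\<close> and agree with the weighted tolerance of
  the search.
\<close>

lemma smoothing_error:
  assumes "1 \<le> t"
  shows "(real t / (\<tau> * P)) powr q * ((q - \<kappa>) / (\<kappa> * q) *
    ((al t * L) powr (q / (q - \<kappa>)) / \<mu> powr (\<kappa> / (q - \<kappa>)))) = err / real t"
proof -
  note r = parameter_ranges
  have "beta_par q \<kappa> * q = (q - \<kappa>) * (q + 1)"
    using r by (simp add: beta_par_def field_simps)
  then have beta: "beta_par q \<kappa> * q / (q - \<kappa>) = q + 1"
    using r by simp
  have "(al t * L) powr (q / (q - \<kappa>))
      = (\<tau> * P) powr q * ((al0 * L) powr (q / (q - \<kappa>)) / real t powr (q + 1))"
    using r P_pos al0_pos assms by (simp add: al_eq powr_mult powr_divide powr_powr beta)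
  then have "(real t / (\<tau> * P)) powr q * ((q - \<kappa>) / (\<kappa> * q) *
    ((al t * L) powr (q / (q - \<kappa>)) / \<mu> powr (\<kappa> / (q - \<kappa>))))
    = ((al0 * L) powr (q / (q - \<kappa>)) / \<mu> powr (\<kappa> / (q - \<kappa>))) * ((q - \<kappa>) / (\<kappa> * q)) / real t"
    using r P_pos assms by (simp add: powr_divide powr_add mult_ac)
  then show ?thesis
    by (simp only: al0_power err_def)
qed

lemma run_iteration:
  assumes "run T x xag calls" "1 \<le> t" "t \<le> T"
  shows "amd_iteration d N F gF \<psi> g\<psi> q \<mu> (Cs t) (ep t) (al t) (et t)
    (x t) (xag t) (x (Suc t)) (xag (Suc t)) (calls t)"
  using assms by (simp add: tuned_run_def amd_run_def)

lemma run_start: "run T x xag calls \<Longrightarrow> x 1 = x1 \<and> xag 1 = x1"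
  by (simp add: tuned_run_def amd_run_def)

lemma run_Rd:
  assumes "run T x xag calls" "1 \<le> t" "t \<le> Suc T"
  shows "x t \<in> Rd d \<and> xag t \<in> Rd d"
proof (cases "t = 1")
  case True
  then show ?thesis
    using run_start[OF assms(1)] x1_Rd by simp
next
  case False
  then obtain j where "t = Suc j" "1 \<le> j" "j \<le> T"
    using assms by (cases t) auto
  then show ?thesis
    using run_iteration[OF assms(1), of j] by (auto simp: amd_iteration_def Let_def is_arg_min_def)
qed

lemma run_recurrence:
  assumes "run T x xag calls" "1 \<le> t" "t \<le> T"
  shows "W * real t powr P * (F (xag (Suc t)) - F xs) + D (x (Suc t))
    \<le> W * (real t powr P - P * real t powr (P - 1)) * (F (xag t) - F xs) + D (x t) + 2 * err / real t"
proof -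
  have "et t / \<tau> = W * P * real t powr (P - 1)"
    using et_eq'[OF assms(2)] parameter_ranges by simp
  then show ?thesis
    using iteration_inequality[OF run_iteration[OF assms], of "real t / (\<tau> * P)"]
      run_Rd[OF assms(1), of t] al_pos theta_pos et_eq[of t] Cs_eq assms
    unfolding smoothing_error[OF assms(2)] et_theta[OF assms(2)] et_ep[OF assms(2)]
    by (simp add: algebra_simps)
qed

definition initial :: real where "initial = W * (F x1 - F xs) + \<mu> * B"

lemma D_x1: "D x1 \<le> \<mu> * B"
  using bregman_x1 parameter_ranges by (simp add: field_simps)

text \<open>
  Sum the recurrence, multiplied by \<open>exp (2 * P / t)\<close>; the weights lie between \<open>1\<close> and
  \<open>exp (2 * P)\<close>, and the errors add up to a harmonic sum.
\<close>

lemma potential_bound: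
  assumes "run T x xag calls" "1 \<le> t" "t \<le> T"
  shows "W * real t powr P * (F (xag (Suc t)) - F xs) + D (x (Suc t))
    \<le> exp (2 * P) * (initial + 2 * err * (1 + ln (real t)))"
proof -
  define \<Phi> where "\<Phi> t = W * real t powr P * (F (xag (Suc t)) - F xs) + D (x (Suc t))" for t
  have \<Phi>_nonneg: "0 \<le> \<Phi> t" if "1 \<le> t" "t \<le> T" for t
    using run_Rd[OF assms(1), of "Suc t"] that F_ge W_pos bregman_nonneg by (simp add: \<Phi>_def)
  have "exp (2 * P / real t) * \<Phi> t \<le> exp (2 * P) * (initial + 2 * err * (1 + ln (real t)))"
    using assms(2,3)
  proof (induction t rule: nat_induct_at_least)
    case base
    \<comment> \<open>There is no earlier weight to compare with, so the initial gap enters through \<open>initial\<close>.\<close>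
    have "W * (1 - P) * (F x1 - F xs) \<le> W * 1 * (F x1 - F xs)"
      using W_pos P_pos F_ge[OF x1_Rd] by (intro mult_right_mono mult_left_mono) auto
    then have "\<Phi> 1 \<le> initial + 2 * err"
      using run_recurrence[OF assms(1), of 1] base run_start[OF assms(1)] D_x1
      by (simp add: \<Phi>_def initial_def)
    then show ?case
      by simp
  next
    case (Suc t)
    define n where "n = real (Suc t)"
    have n: "2 \<le> n" "real t = n - 1" "1 \<le> real t"
      using Suc by (auto simp: n_def)
    have in_Rd: "x (Suc t) \<in> Rd d" "xag (Suc t) \<in> Rd d"
      using run_Rd[OF assms(1), of "Suc t"] Suc by auto
    have "exp (2 * P / n) * \<Phi> (Suc t)
      \<le> exp (2 * P / n) * (W * (n powr P - P * n powr (P - 1)) * (F (xag (Suc t)) - F xs)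
        + D (x (Suc t)) + 2 * err / n)"
      using run_recurrence[OF assms(1), of "Suc t"] Suc 
      by (intro mult_left_mono) (auto simp: \<Phi>_def n_def)
    also have "\<dots> = (W * (F (xag (Suc t)) - F xs)) * (exp (2 * P / n) * (n powr P - P * n powr (P - 1)))
        + exp (2 * P / n) * D (x (Suc t)) + exp (2 * P / n) * (2 * err / n)"
      by (simp add: algebra_simps)
    also have "\<dots> \<le> (W * (F (xag (Suc t)) - F xs)) * (exp (2 * P / (n - 1)) * (n - 1) powr P)
        + exp (2 * P / (n - 1)) * D (x (Suc t)) + exp (2 * P) * (2 * err * (ln n - ln (n - 1)))"
    proof (rule add_mono[OF add_mono])
      show "W * (F (xag (Suc t)) - F xs) * (exp (2 * P / n) * (n powr P - P * n powr (P - 1)))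
          \<le> W * (F (xag (Suc t)) - F xs) * (exp (2 * P / (n - 1)) * (n - 1) powr P)"
        using weight_decrease[OF P_pos n(1)] W_pos F_ge[OF in_Rd(2)] by (intro mult_left_mono) auto
      show "exp (2 * P / n) * D (x (Suc t)) \<le> exp (2 * P / (n - 1)) * D (x (Suc t))"
        using n bregman_nonneg[OF xs_Rd in_Rd(1)] by (intro mult_right_mono) (simp_all add: frac_le)
      have "ln ((n - 1) / n) \<le> (n - 1) / n - 1"
        using n by (intro ln_le_minus_one) auto
      then have "1 / n \<le> ln n - ln (n - 1)"
        using n by (subst (asm) ln_div) (auto simp: diff_divide_distrib)
      then have "2 * err * (1 / n) \<le> 2 * err * (ln n - ln (n - 1))"
        using err_pos by (intro mult_left_mono) auto
      moreover have "exp (2 * P / n) \<le> exp (2 * P)"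
        using n P_pos by (simp add: field_simps)
      ultimately show "exp (2 * P / n) * (2 * err / n) \<le> exp (2 * P) * (2 * err * (ln n - ln (n - 1)))"
        using n err_pos by (intro mult_mono) auto
    qed
    also have "\<dots> = exp (2 * P / (n - 1)) * \<Phi> t + exp (2 * P) * (2 * err * (ln n - ln (n - 1)))"
      unfolding \<Phi>_def n(2) by (simp add: algebra_simps)
    also have "\<dots> \<le> exp (2 * P) * (initial + 2 * err * (1 + ln (n - 1)))
        + exp (2 * P) * (2 * err * (ln n - ln (n - 1)))"
      using Suc n by simp
    also have "\<dots> = exp (2 * P) * (initial + 2 * err * (1 + ln n))"
      by (simp add: algebra_simps)
    finally show ?case
      by (simp add: n_def)
  qed
  moreover have "\<Phi> t \<le> exp (2 * P / real t) * \<Phi> t"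
    using mult_right_mono[of 1 "exp (2 * P / real t)" "\<Phi> t"] \<Phi>_nonneg[OF assms(2,3)] P_pos by simp
  ultimately show ?thesis
    unfolding \<Phi>_def by linarith
qed

end

section \<open>Convergence rate\<close>

context amd_problem
begin

text \<open>
  Along the ray from the minimizer through \<open>y\<close>, star-convexity says that the gap divided by
  \<open>s powr (1 / \<tau>)\<close> is nondecreasing, so the gap grows at least like \<open>s powr (1 / \<tau>)\<close>; weak
  smoothness allows at most \<open>s powr \<kappa>\<close>.
\<close>

lemma tau_lower_bound:
  assumes y: "y \<in> Rd d" and "F xs < F y"
  shows "1 \<le> \<kappa> * \<tau>"
proof (rule ccontr)
  assume "\<not> 1 \<le> \<kappa> * \<tau>"
  note r = parameter_ranges
  define c where "c = 1 / \<tau> - \<kappa>"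
  have c: "0 < c"
    using \<open>\<not> 1 \<le> \<kappa> * \<tau>\<close> r by (simp add: c_def field_simps)
  define v where "v = y - xs"
  have v [simp]: "v \<in> Rd d"
    using y by (simp add: v_def)
  define h where "h s = F (xs + s *\<^sub>R v) - F xs" for s
  have h1: "0 < h 1"
    using assms by (simp add: h_def v_def)
  have der: "((\<lambda>s. h s * s powr (- (1 / \<tau>))) has_real_derivative
      ip d (gF (xs + s *\<^sub>R v)) v * s powr (- (1 / \<tau>)) + h s * (- (1 / \<tau>) * s powr (- (1 / \<tau>) - 1))) (at s)"
    if "1 \<le> s" for s
    unfolding h_def using that
    by (auto intro!: derivative_eq_intros line_derivative[OF C1(1)])
  have nonneg: "0 \<le> ip d (gF (xs + s *\<^sub>R v)) v * s powr (- (1 / \<tau>))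
      + h s * (- (1 / \<tau>) * s powr (- (1 / \<tau>) - 1))" if "1 \<le> s" for s
  proof -
    have "h s \<le> \<tau> * (s * ip d (gF (xs + s *\<^sub>R v)) v)"
      using star_convex[of "xs + s *\<^sub>R v"] by (simp add: h_def ip_scaleR)
    then have "h s / \<tau> \<le> s * ip d (gF (xs + s *\<^sub>R v)) v"
      using r by (simp add: field_simps)
    then have "0 \<le> s powr (- (1 / \<tau>) - 1) * (s * ip d (gF (xs + s *\<^sub>R v)) v - h s / \<tau>)"
      by simp
    also have "\<dots> = ip d (gF (xs + s *\<^sub>R v)) v * (s powr (- (1 / \<tau>) - 1) * s)
        + h s * (- (1 / \<tau>) * s powr (- (1 / \<tau>) - 1))"
      by (simp add: algebra_simps)
    also have "s powr (- (1 / \<tau>) - 1) * s = s powr (- (1 / \<tau>))"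
      using that by (simp add: powr_diff)
    finally show ?thesis .
  qed
  define K where "K = L / \<kappa> * N v powr \<kappa>"
  have growth: "h 1 * s powr c \<le> K" if "1 \<le> s" for s
  proof -
    have "h 1 * 1 powr (- (1 / \<tau>)) \<le> h s * s powr (- (1 / \<tau>))"
      using that der nonneg by (intro DERIV_nonneg_imp_nondecreasing[OF that]) blast
    then have "h 1 \<le> h s * s powr (- (1 / \<tau>))"
      by simp
    also have "h s \<le> K * s powr \<kappa>"
      using gap_le[of "xs + s *\<^sub>R v"] that norm_nonneg[OF v]
      by (simp add: h_def K_def norm_scaleR powr_mult mult_ac)
    then have "h s * s powr (- (1 / \<tau>)) \<le> K * s powr \<kappa> * s powr (- (1 / \<tau>))"
      by (rule mult_right_mono) simp
    also have "\<dots> = K * s powr (- c)"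
      by (simp add: c_def flip: powr_add)
    finally have "h 1 * s powr c \<le> K * s powr (- c) * s powr c"
      by (rule mult_right_mono) simp
    also have "\<dots> = K * (s powr (- c) * s powr c)"
      by simp
    also have "s powr (- c) * s powr c = 1"
      using that by (simp flip: powr_add)
    finally show ?thesis
      by simp
  qed
  \<comment> \<open>At this point of the ray the lower bound on the gap exceeds the upper bound.\<close>
  define s where "s = (max 1 ((K + 1) / h 1)) powr (1 / c)"
  have "1 \<le> s"
    unfolding s_def using c by (intro ge_one_powr_ge_zero) auto
  have "(K + 1) / h 1 \<le> s powr c"
    using c by (simp add: s_def powr_powr)
  then have "K + 1 \<le> h 1 * s powr c"
    using h1 by (simp add: field_simps)
  then show False
    using growth[OF \<open>1 \<le> s\<close>] by linarith
qed

end

context tuned_amd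
begin

lemma initial_nonneg: "\<mu> * B \<le> initial" "0 < initial"
  using W_pos F_ge[OF x1_Rd] parameter_ranges B_pos by (auto simp: initial_def add_nonneg_pos)

lemma err_W: "err / W = P powr \<kappa> * ((q - \<kappa>) / (\<kappa> * q)) * ((q - \<kappa>) / \<kappa>) powr (\<kappa> / q)
    * (L * \<tau> powr \<kappa> * B powr (\<kappa> / q))"
proof -
  note r = parameter_ranges
  define b where "b = (q - \<kappa>) * B / \<kappa>"
  have b: "0 < b"
    using r B_pos by (simp add: b_def)
  define y where "y = (q - \<kappa>) / (\<kappa> * q)"
  have "err = \<mu> * b * y" "W = \<mu> / L * b powr ((q - \<kappa>) / q) / (\<tau> powr \<kappa> * P powr \<kappa>)"
    by (simp_all add: err_def W_def alpha_par_def b_def y_def powr_mult)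
  then have "err / W = L * \<tau> powr \<kappa> * P powr \<kappa> * ((q - \<kappa>) / (\<kappa> * q)) * (b / b powr ((q - \<kappa>) / q))"
    using r unfolding y_def[symmetric] by (simp add: mult_ac)
  also have "b / b powr ((q - \<kappa>) / q) = b powr (\<kappa> / q)"
  proof -
    have "1 - (q - \<kappa>) / q = \<kappa> / q"
      using r by (simp add: field_simps)
    then show ?thesis
      using b powr_diff[of b 1 "(q - \<kappa>) / q"] by simp
  qed
  also have "b powr (\<kappa> / q) = ((q - \<kappa>) / \<kappa>) powr (\<kappa> / q) * B powr (\<kappa> / q)"
    using r B_pos by (simp add: b_def powr_mult powr_divide)
  finally show ?thesis
    by (simp add: mult_ac)
qed

definition gap_constant :: real where
  "gap_constant = 4 * exp (2 * P) * P powr \<kappa> * ((q - \<kappa>) / (\<kappa> * q))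
     * ((q - \<kappa>) / \<kappa>) powr (\<kappa> / q) * \<kappa> powr (q - \<kappa>)"

text \<open>
  The energy argument gives \<open>\<tau> powr \<kappa>\<close>. It may be replaced by \<open>\<tau> powr q\<close> up to a constant: either
  the gap vanishes, or \<open>\<kappa> * \<tau> \<ge> 1\<close>. For large \<open>T\<close> the logarithm dominates the initial energy,
  which therefore does not enter the constant.
\<close>

lemma gap_bound:
  assumes "run T x xag calls" "1 \<le> T" and ln: "initial + 2 * err \<le> 2 * err * ln (real T)"
  shows "\<bar>F (xag (Suc T)) - F xs\<bar> \<le> gap_constant
      * (L * \<tau> powr q * B powr (\<kappa> / q) * (ln (real T) / real T powr P))"
proof (cases "F xs < F (xag (Suc T))")
  case True
  note r = parameter_ranges
  have in_Rd: "x (Suc T) \<in> Rd d" "xag (Suc T) \<in> Rd d"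
    using run_Rd[OF assms(1), of "Suc T"] by auto
  have lnT: "0 \<le> ln (real T)"
    using assms(2) by simp
  have "W * real T powr P * (F (xag (Suc T)) - F xs)
      \<le> exp (2 * P) * (initial + 2 * err * (1 + ln (real T)))"
    using potential_bound[OF assms(1,2)] bregman_nonneg[OF xs_Rd in_Rd(1)] by simp
  also have "\<dots> \<le> exp (2 * P) * (4 * err * ln (real T))"
    using ln by (intro mult_left_mono) (auto simp: algebra_simps)
  finally have "F (xag (Suc T)) - F xs \<le> 4 * exp (2 * P) * (err / W) * (ln (real T) / real T powr P)"
    using W_pos assms(2) by (simp add: field_simps)
  also have "err / W \<le> P powr \<kappa> * ((q - \<kappa>) / (\<kappa> * q)) * ((q - \<kappa>) / \<kappa>) powr (\<kappa> / q)
    * (L * (\<kappa> powr (q - \<kappa>) * \<tau> powr q) * B powr (\<kappa> / q))"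
  proof -
    have "1 \<le> (\<kappa> * \<tau>) powr (q - \<kappa>)"
      using tau_lower_bound[OF in_Rd(2) True] r by (intro ge_one_powr_ge_zero) auto
    then have "\<tau> powr \<kappa> * 1 \<le> \<tau> powr \<kappa> * (\<kappa> * \<tau>) powr (q - \<kappa>)"
      by (intro mult_left_mono) auto
    also have "\<dots> = \<kappa> powr (q - \<kappa>) * \<tau> powr q"
      using r by (simp add: powr_mult powr_diff)
    finally show ?thesis
      unfolding err_W using r P_pos by (intro mult_left_mono mult_right_mono) auto
  qed
  finally have "F (xag (Suc T)) - F xs \<le> 4 * exp (2 * P) * (P powr \<kappa> * ((q - \<kappa>) / (\<kappa> * q))
      * ((q - \<kappa>) / \<kappa>) powr (\<kappa> / q) * (L * (\<kappa> powr (q - \<kappa>) * \<tau> powr q) * B powr (\<kappa> / q)))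
      * (ln (real T) / real T powr P)"
    using lnT by (simp add: mult_left_mono mult_right_mono divide_right_mono)
  also have "\<dots> = gap_constant * (L * \<tau> powr q * B powr (\<kappa> / q) * (ln (real T) / real T powr P))"
    unfolding gap_constant_def by (simp only: mult_ac)
  finally show ?thesis
    using True by simp
next
  case False
  then have "F (xag (Suc T)) - F xs = 0"
    using F_ge[of "xag (Suc T)"] run_Rd[OF assms(1), of "Suc T"] by force
  then show ?thesis
    using parameter_ranges assms(2) by (simp add: gap_constant_def)
qed

section \<open>Oracle complexity\<close>

text \<open>
  Above the stated bound, \<open>y powr q\<close> is more than twice each of the two terms on the right.
\<close>

lemma power_inequality_bound:
  fixes y R c :: real
  assumes "y powr q \<le> c * (R powr \<kappa> + y powr \<kappa>)" "0 \<le> y" "1 \<le> R" "0 \<le> c" 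
  shows "y \<le> (2 * c + 1) powr (1 / (q - \<kappa>)) * R powr (\<kappa> / q)"
proof (rule ccontr)
  note r = parameter_ranges
  define a where "a = (2 * c + 1) powr (1 / (q - \<kappa>))"
  assume "\<not> ?thesis"
  then have y: "a * R powr (\<kappa> / q) < y"
    by (simp add: a_def)
  have R1: "1 \<le> R powr (\<kappa> / q)"
    using assms r by (intro ge_one_powr_ge_zero) auto
  have a1: "1 \<le> a"
    unfolding a_def using assms r by (intro ge_one_powr_ge_zero) auto
  have a_pow: "a powr (q - \<kappa>) = 2 * c + 1"
    using assms r by (simp add: a_def powr_powr)
  have ay: "a < y"
    using y R1 a1 mult_left_mono[of 1 "R powr (\<kappa> / q)" a] by linarith
  have "2 * c * R powr \<kappa> < y powr q"
  proof -
    have "2 * c + 1 \<le> a powr q"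
      unfolding a_pow[symmetric] using a1 r by (intro powr_mono) auto
    then have "2 * c * R powr \<kappa> < a powr q * R powr \<kappa>"
      using assms by (intro mult_strict_right_mono) auto
    also have "\<dots> = (a * R powr (\<kappa> / q)) powr q"
      using a1 assms r by (simp add: powr_mult powr_powr)
    also have "\<dots> \<le> y powr q"
      using y a1 R1 r by (intro powr_mono2) auto
    finally show ?thesis .
  qed
  moreover have "2 * c * y powr \<kappa> < y powr q"
  proof -
    have "2 * c + 1 \<le> y powr (q - \<kappa>)"
      unfolding a_pow[symmetric] using a1 ay r by (intro powr_mono2) auto
    then have "2 * c * y powr \<kappa> < y powr (q - \<kappa>) * y powr \<kappa>"
      using ay a1 by (intro mult_strict_right_mono) auto
    then show ?thesis
      using ay a1 by (simp flip: powr_add)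
  qed
  ultimately show False
    using assms(1) by (simp add: algebra_simps)
qed

text \<open>
  The iterates stay within a distance of order \<open>t powr growth_exponent\<close> of the minimizer.
\<close>

definition growth_exponent :: real where "growth_exponent = q / (q - \<kappa>)"

lemma growth_exponent: "1 \<le> growth_exponent" "growth_exponent * (\<kappa> / q) = growth_exponent - 1"
  using parameter_ranges by (simp_all add: growth_exponent_def field_simps)

text \<open>
  Deliberately crude: the energy bounds the \<open>q\<close>-th power of the distance by a multiple of
  \<open>1 + ln t\<close>, but any polynomial bound serves the count of oracle calls.
\<close>

lemma mirror_iterate_bound:
  assumes "run T x xag calls" "1 \<le> t" "t \<le> Suc T"
  shows "N (x t - xs) \<le> (1 + q / \<mu> * (exp (2 * P) * (initial + 2 * err))) * real t"
proof -
  note r = parameter_ranges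
  have x: "x t \<in> Rd d"
    using run_Rd[OF assms] by simp
  have "D (x t) \<le> exp (2 * P) * (initial + 2 * err) * real t"
  proof (cases "t = 1")
    case True
    have "D (x t) \<le> 1 * (initial + 2 * err)"
      using True run_start[OF assms(1)] D_x1 initial_nonneg err_pos by simp
    also have "\<dots> \<le> exp (2 * P) * (initial + 2 * err)"
      using initial_nonneg err_pos by (intro mult_right_mono) auto
    finally show ?thesis
      using True by simp
  next
    case False
    then obtain j where j: "t = Suc j" "1 \<le> j" "j \<le> T"
      using assms by (cases t) auto
    have xag: "xag t \<in> Rd d"
      using run_Rd[OF assms] by simp
    have "0 \<le> W * real j powr P * (F (xag t) - F xs)"
      using W_pos F_ge[OF xag] by simp
    then have "D (x t) \<le> exp (2 * P) * (initial + 2 * err * (1 + ln (real j)))"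
      using potential_bound[OF assms(1) j(2,3)] j(1) by simp
    also have "\<dots> \<le> exp (2 * P) * (initial * real t + 2 * err * real t)"
    proof (intro mult_left_mono add_mono)
      show "1 + ln (real j) \<le> real t"
        using ln_le_minus_one[of "real j"] j by simp
      show "initial \<le> initial * real t"
        using mult_left_mono[of 1 "real t" initial] initial_nonneg assms by simp
    qed (use err_pos in auto)
    finally show ?thesis
      by (simp add: algebra_simps)
  qed
  then have "\<mu> / q * N (x t - xs) powr q \<le> exp (2 * P) * (initial + 2 * err) * real t"
    using bregman_ge[OF xs_Rd x] norm_minus_commute[OF x xs_Rd] by simp
  then have *: "N (x t - xs) powr q \<le> q / \<mu> * (exp (2 * P) * (initial + 2 * err)) * real t"
    using r by (simp add: field_simps)
  have "N (x t - xs) \<le> 1 + N (x t - xs) powr q"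
  proof (cases "N (x t - xs) \<le> 1")
    case False
    then show ?thesis
      using powr_mono[of 1 q "N (x t - xs)"] r by simp
  qed (simp add: add_increasing2)
  also have "\<dots> \<le> real t + q / \<mu> * (exp (2 * P) * (initial + 2 * err)) * real t"
    using * assms by (intro add_mono) auto
  finally show ?thesis
    by (simp add: algebra_simps)
qed

text \<open>
  The mirror iterates are controlled by the energy. If all iterates so far are within \<open>R\<close> of the
  minimizer, then the next aggregated one is within \<open>R + O(R powr (\<kappa> / q))\<close>, and
  \<open>R = A * t powr m\<close> with \<open>m = q / (q - \<kappa>)\<close> is a supersolution of this recursion because
  \<open>m * \<kappa> / q = m - 1\<close>.
\<close>

lemma iterates_polynomially_bounded:
  "\<exists>A\<ge>1. \<forall>T x xag calls. run T x xag calls \<longrightarrow> (\<forall>t. 1 \<le> t \<longrightarrow> t \<le> Suc T \<longrightarrow>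
     N (x t - xs) \<le> A * real t powr growth_exponent \<and> N (xag t - xs) \<le> A * real t powr growth_exponent)"
proof -
  note r = parameter_ranges
  define m where "m = growth_exponent"
  define A0 where "A0 = 1 + q / \<mu> * (exp (2 * P) * (initial + 2 * err))"
  define c where "c = al 1 * L * q / (\<kappa> * \<mu>)"
  define a where "a = (2 * c + 1) powr (1 / (q - \<kappa>))"
  define A where "A = max A0 (a powr m)"
  have m: "1 \<le> m" "m * (\<kappa> / q) = m - 1"
    using growth_exponent by (auto simp: m_def)
  have c: "0 \<le> c"
    using r al_pos[of 1] by (simp add: c_def)
  have "1 \<le> A0"
    using r initial_nonneg err_pos by (simp add: A0_def)
  then have A: "1 \<le> A" "A0 \<le> A" "a powr m \<le> A"
    by (auto simp: A_def)
  have aA: "a * A powr (\<kappa> / q) \<le> A"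
  proof -
    have "m * (1 - \<kappa> / q) = 1"
      using m by (simp add: algebra_simps)
    then have "a = (a powr m) powr (1 - \<kappa> / q)"
      using c by (simp add: a_def powr_powr)
    also have "\<dots> \<le> A powr (1 - \<kappa> / q)"
      using A r by (intro powr_mono2) auto
    finally have "a * A powr (\<kappa> / q) \<le> A powr (1 - \<kappa> / q) * A powr (\<kappa> / q)"
      by (rule mult_right_mono) simp
    then show ?thesis
      using A by (simp flip: powr_add)
  qed
  have "N (x t - xs) \<le> A * real t powr m \<and> N (xag t - xs) \<le> A * real t powr m"
    if run: "run T x xag calls" and "1 \<le> t" "t \<le> Suc T" for T x xag calls t
  proof -
    have mirror: "N (x t - xs) \<le> A * real t powr m" if "1 \<le> t" "t \<le> Suc T" for t
    proof -
      have "N (x t - xs) \<le> A0 * real t"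
        using mirror_iterate_bound[OF run that] by (simp add: A0_def)
      also have "\<dots> \<le> A * real t powr m"
        using A m that powr_mono[of 1 m "real t"] by (intro mult_mono) auto
      finally show ?thesis .
    qed
    have "N (xag t - xs) \<le> A * real t powr m"
      using that(2,3)
    proof (induction t rule: nat_induct_at_least)
      case base
      then show ?case
        using mirror[of 1] run_start[OF run] by simp
    next
      case (Suc t)
      define R where "R = A * real t powr m"
      have t: "1 \<le> t" "t \<le> T" "1 \<le> real t"
        using Suc by auto
      have R: "N (x t - xs) \<le> R" "N (xag t - xs) \<le> R"
        using Suc mirror[of t] by (auto simp: R_def)
      have R1: "1 \<le> R"
        using A m t mult_mono[of 1 A 1 "real t powr m"] ge_one_powr_ge_zero[of "real t" m]
        by (simp add: R_def)
      obtain y where y: "0 \<le> y" "N (xag (Suc t) - xs) \<le> R + y"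
        "y powr q \<le> al t * L * q / (\<kappa> * \<mu>) * (R powr \<kappa> + y powr \<kappa>)"
        using iteration_ag_step[OF run_iteration[OF run t(1,2)] _ _ al_pos[OF t(1)] R]
          run_Rd[OF run t(1)] t by auto
      note y(3)
      also have "al t * L * q / (\<kappa> * \<mu>) * (R powr \<kappa> + y powr \<kappa>) \<le> c * (R powr \<kappa> + y powr \<kappa>)"
        unfolding c_def using r al_le[OF t(1)]
        by (intro mult_right_mono divide_right_mono) auto
      finally have "y \<le> a * R powr (\<kappa> / q)"
        unfolding a_def using y(1) R1 c by (intro power_inequality_bound) auto
      also have "\<dots> = a * A powr (\<kappa> / q) * real t powr (m - 1)"
        using A t m(2) by (simp add: R_def powr_mult powr_powr)
      also have "\<dots> \<le> A * real t powr (m - 1)"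
        using aA by (rule mult_right_mono) simp
      finally have "N (xag (Suc t) - xs) \<le> A * (real t powr m + real t powr (m - 1))"
        using y(2) by (simp add: R_def algebra_simps)
      also have "real t powr m + real t powr (m - 1) = real t powr (m - 1) * real (Suc t)"
        using t by (simp add: powr_diff field_simps)
      also have "\<dots> \<le> real (Suc t) powr (m - 1) * real (Suc t)"
        using m by (intro mult_right_mono powr_mono2) auto
      also have "\<dots> = real (Suc t) powr m"
        by (simp add: powr_diff)
      finally show ?case
        using A by simp
    qed
    then show ?thesis
      using mirror that by blast
  qed
  then show ?thesis
    using A(1) unfolding m_def by blast
qed

definition call_rate :: real where
  "call_rate = 3 * (growth_exponent * \<kappa> + P) / ((\<kappa> - 1) * ln 2)"

text \<open>
  The number of bisections is logarithmic in the ratio of the Hoelder constant of the segment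
  function to the tolerance. Both are powers of \<open>t\<close> up to constants, by the bound on the iterates
  and the choice of the parameters. Only the factor of \<open>ln t\<close> has to be uniform over all problem
  data.
\<close>

lemma oracle_calls_logarithmic:
  "\<exists>H. \<forall>T x xag calls. run T x xag calls \<longrightarrow> (\<forall>t. 1 \<le> t \<longrightarrow> t \<le> Suc T \<longrightarrow>
     (\<exists>l n. binary_search (segment_gap F (x t) (xag t)) (Cs t) (ep t) l n) \<and>
     (\<forall>l n. binary_search (segment_gap F (x t) (xag t)) (Cs t) (ep t) l n \<longrightarrow>
        real (n + 1) \<le> H + call_rate * ln (real t)))"
proof -
  note r = parameter_ranges
  obtain A where A: "1 \<le> A" and dist: "\<And>T x xag calls t. run T x xag calls \<Longrightarrow> 1 \<le> t \<Longrightarrow> t \<le> Suc T \<Longrightarrow>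
      N (x t - xs) \<le> A * real t powr growth_exponent \<and> N (xag t - xs) \<le> A * real t powr growth_exponent"
    using iterates_polynomially_bounded by blast
  define Q where "Q = 2 * (L / \<kappa> * (2 * A) powr \<kappa>) * (\<tau> * (W * P)) / err"
  have Q: "0 < Q"
    using r A W_pos err_pos by (simp add: Q_def)
  define H where "H = 7 + 3 * \<bar>ln Q\<bar> / ((\<kappa> - 1) * ln 2)"
  have H7: "7 \<le> H"
    using r by (simp add: H_def)
  have "(\<exists>l n. binary_search (segment_gap F (x t) (xag t)) (Cs t) (ep t) l n) \<and>
     (\<forall>l n. binary_search (segment_gap F (x t) (xag t)) (Cs t) (ep t) l n \<longrightarrow>
        real (n + 1) \<le> H + call_rate * ln (real t))"
    if run: "run T x xag calls" and t: "1 \<le> t" "t \<le> Suc T" for T x xag calls t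
  proof (cases "t = 1")
    case True
    have "segment_gap F (x t) (xag t) = (\<lambda>_. 0)"
      using True run_start[OF run] by (simp add: segment_gap_def segment_point_def fun_eq_iff flip: scaleR_add_left)
    then have "deriv (segment_gap F (x t) (xag t)) 1 \<le> ep t"
      using ep_pos[OF t(1)] by simp
    then have "\<exists>l n. binary_search (segment_gap F (x t) (xag t)) (Cs t) (ep t) l n"
      and "\<And>l n. binary_search (segment_gap F (x t) (xag t)) (Cs t) (ep t) l n \<Longrightarrow> n = 1"
      by (auto intro: binary_search.one elim: binary_search.cases)
    then show ?thesis
      using H7 True by force
  next
    case False
    define e where "e = ep t"
    have e: "0 < e"
      using ep_pos[OF t(1)] by (simp add: e_def)
    have in_Rd: "x t \<in> Rd d" "xag t \<in> Rd d"
      using run_Rd[OF run t] by auto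
    define R where "R = A * real t powr growth_exponent"
    define K where "K = L / \<kappa> * (2 * R) powr \<kappa>"
    have R: "0 < R"
      using A t by (simp add: R_def)
    have K: "0 < K"
      using r R by (simp add: K_def)
    have "N (xag t - x t) \<le> N (xag t - xs) + N (x t - xs)"
      using norm_triangle[of "xag t - xs" "xs - x t"] norm_minus_commute[of "x t" xs] in_Rd by simp
    also have "\<dots> \<le> 2 * R"
      using dist[OF run t] by (simp add: R_def)
    finally have NK: "L / \<kappa> * N (xag t - x t) powr \<kappa> \<le> K"
      unfolding K_def using r norm_nonneg in_Rd by (intro mult_left_mono powr_mono2) auto
    have hoelder: "\<bar>segment_gap F (x t) (xag t) s - segment_gap F (x t) (xag t) s'
        - ip d (gF (segment_point (x t) (xag t) s')) (xag t - x t) * (s - s')\<bar>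
        \<le> K * \<bar>s - s'\<bar> powr \<kappa>" for s s'
      using segment_gap_hoelder[OF in_Rd, of s s'] mult_right_mono[OF NK, of "\<bar>s - s'\<bar> powr \<kappa>"]
      by simp
    \<comment> \<open>The bracket length below which the search must have stopped.\<close>
    define w where "w = (e / (2 * K)) powr (1 / (\<kappa> - 1))"
    have w: "0 < w"
      using e K by (simp add: w_def)
    have w_pow: "2 * K * w powr (\<kappa> - 1) \<le> e"
      using e K r by (simp add: w_def powr_powr)
    define k where "k = nat \<lceil>log 2 (1 / w)\<rceil>"
    have "log 2 (1 / w) \<le> real k"
      unfolding k_def by linarith
    then have "1 / w \<le> 2 powr real k"
      using w by (simp add: log_le_iff)
    then have k: "1 \<le> 2 ^ k * w"
      using w by (simp add: powr_realpow field_simps)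
    have *: "(\<exists>l n. binary_search (segment_gap F (x t) (xag t)) (Cs t) e l n)
      \<and> (\<forall>l n. binary_search (segment_gap F (x t) (xag t)) (Cs t) e l n \<longrightarrow> n \<le> 3 * k + 3)"
      using K r e w w_pow k Cs_nonneg[of t] False t segment_gap_1
      by (intro binary_search_halts[OF segment_gap_derivative[OF in_Rd] hoelder]) auto
    have "2 * K / e = Q * real t powr (growth_exponent * \<kappa> + P)"
    proof -
      have "e = et t * ep t / et t"
        using et_pos[OF t(1)] by (simp add: e_def)
      then have "e = err / real t / et t"
        by (simp only: et_ep[OF t(1)])
      then show ?thesis
        using r A t err_pos
        by (simp add: K_def R_def Q_def et_eq' powr_mult powr_powr powr_add powr_diff field_simps)
    qed
    then have "ln (2 * K / e) = ln Q + (growth_exponent * \<kappa> + P) * ln (real t)"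
      using Q t by (simp add: ln_mult ln_powr)
    moreover have "1 / w = (2 * K / e) powr (1 / (\<kappa> - 1))"
      using e K by (simp add: w_def powr_divide)
    then have "log 2 (1 / w) = ln (2 * K / e) / ((\<kappa> - 1) * ln 2)"
      using e K by (simp add: log_def ln_powr)
    ultimately have "log 2 (1 / w) \<le> (\<bar>ln Q\<bar> + (growth_exponent * \<kappa> + P) * ln (real t)) / ((\<kappa> - 1) * ln 2)"
      using r by (simp add: divide_right_mono)
    moreover have "real k \<le> max 0 (log 2 (1 / w)) + 1"
      unfolding k_def by linarith
    moreover have "0 \<le> (\<bar>ln Q\<bar> + (growth_exponent * \<kappa> + P) * ln (real t)) / ((\<kappa> - 1) * ln 2)"
      using r growth_exponent(1) t by simp
    ultimately have "real k \<le> (\<bar>ln Q\<bar> + (growth_exponent * \<kappa> + P) * ln (real t)) / ((\<kappa> - 1) * ln 2) + 1"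
      by linarith
    moreover have "H + call_rate * ln (real t) = 7 + 3 * ((\<bar>ln Q\<bar> + (growth_exponent * \<kappa> + P) * ln (real t)) / ((\<kappa> - 1) * ln 2))"
    proof -
      have "7 + 3 * a / c + 3 * p / c * l = 7 + 3 * ((a + p * l) / c)" for a c p l :: real
        by (simp add: add_divide_distrib distrib_left)
      then show ?thesis
        unfolding H_def call_rate_def .
    qed
    ultimately have "3 * real k + 4 \<le> H + call_rate * ln (real t)"
      by linarith
    then show ?thesis
      using * unfolding e_def by force
  qed
  then show ?thesis
    by blast
qed

lemma total_calls_bound:
  obtains H where "\<And>T x xag calls. run T x xag calls \<Longrightarrow> 1 \<le> T \<Longrightarrow>
    real (\<Sum>t=1..T. calls t) \<le> real T * (H + call_rate * ln (real T))"
proof -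
  obtain H where H: "\<And>T x xag calls t l n. run T x xag calls \<Longrightarrow> 1 \<le> t \<Longrightarrow> t \<le> Suc T \<Longrightarrow>
      binary_search (segment_gap F (x t) (xag t)) (Cs t) (ep t) l n \<Longrightarrow>
      real (n + 1) \<le> H + call_rate * ln (real t)"
    using oracle_calls_logarithmic by blast
  have "real (\<Sum>t=1..T. calls t) \<le> real T * (H + call_rate * ln (real T))"
    if run: "run T x xag calls" and "1 \<le> T" for T x xag calls
  proof -
    have "real (calls t) \<le> H + call_rate * ln (real T)" if t: "t \<in> {1..T}" for t
    proof -
      obtain l m where "binary_search (segment_gap F (x t) (xag t)) (Cs t) (ep t) l m" "calls t = m + 1"
        using run_iteration[OF run, of t] t by (auto simp: amd_iteration_def Let_def)
      then have "real (calls t) \<le> H + call_rate * ln (real t)"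
        using H[OF run, of t] t by simp
      also have "\<dots> \<le> H + call_rate * ln (real T)"
        using t parameter_ranges growth_exponent(1) 
        by (intro add_left_mono mult_left_mono) (auto simp: call_rate_def)
      finally show ?thesis .
    qed
    then have "(\<Sum>t=1..T. real (calls t)) \<le> (\<Sum>t=1..T. H + call_rate * ln (real T))"
      by (rule sum_mono)
    then show ?thesis
      by simp
  qed
  then show thesis
    using that by blast
qed

end

theorem corollary5p1:
  fixes q \<kappa> :: real
  assumes "2 \<le> q" and "1 < \<kappa>" and "\<kappa> \<le> 2" and "\<kappa> < q"
  shows "\<exists>M1>0. \<exists>M2>0.
    \<forall>d N F gF \<psi> g\<psi> \<tau> L \<mu> B xs x1.
      standing_assumption d N F gF \<psi> g\<psi> q \<kappa> \<tau> L \<mu> xs \<longrightarrow>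
      x1 \<in> Rd d \<longrightarrow> 0 < B \<longrightarrow> 1 / \<mu> * bregman d \<psi> g\<psi> xs x1 \<le> B \<longrightarrow>
      (\<forall>T x xag calls. tuned_run d N F gF \<psi> g\<psi> q \<kappa> \<tau> L \<mu> B x1 T x xag calls \<longrightarrow>
         (\<exists>l n. binary_search (segment_gap F (x (Suc T)) (xag (Suc T)))
            (C_seq q \<kappa> \<tau> L \<mu> B (Suc T)) (eps_seq q \<kappa> \<tau> L \<mu> B (Suc T)) l n)) \<and>
      (\<exists>T0>0. \<forall>T\<ge>T0. \<forall>x xag calls.
         tuned_run d N F gF \<psi> g\<psi> q \<kappa> \<tau> L \<mu> B x1 T x xag calls \<longrightarrow>
         \<bar>F (xag (Suc T)) - F xs\<bar> \<le>
           M1 * (L * \<tau> powr q * B powr (\<kappa> / q) *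
                 (ln (real T) / real T powr ((\<kappa> * q + \<kappa> - q) / q))) \<and>
         real (\<Sum>t=1..T. calls t) \<le> M2 * (real T * ln (L * B * \<tau> * real T)))"
proof -
  define M1 where "M1 = 1 + \<bar>tuned_amd.gap_constant q \<kappa>\<bar>"
  define M2 where "M2 = 2 * (1 + \<bar>tuned_amd.call_rate q \<kappa>\<bar>)"
  have M: "0 < M1" "0 < M2"
    by (auto simp: M1_def M2_def)
  show ?thesis
  proof (rule exI[of _ M1], rule conjI[OF M(1)], rule exI[of _ M2], rule conjI[OF M(2)],
      intro allI impI, rule conjI)
    fix d N F gF \<psi> g\<psi> \<tau> L \<mu> B xs x1
    assume "standing_assumption d N F gF \<psi> g\<psi> q \<kappa> \<tau> L \<mu> xs" "x1 \<in> Rd d" "0 < B"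
      "1 / \<mu> * bregman d \<psi> g\<psi> xs x1 \<le> B"
    then interpret tuned_amd d N F gF \<psi> g\<psi> q \<kappa> \<tau> L \<mu> xs B x1
      using assms by unfold_locales auto
    show "\<forall>T x xag calls. run T x xag calls \<longrightarrow>
         (\<exists>l n. binary_search (segment_gap F (x (Suc T)) (xag (Suc T))) (Cs (Suc T)) (ep (Suc T)) l n)"
      using oracle_calls_logarithmic by (metis le_refl le_add1 plus_1_eq_Suc)
    obtain H where H: "\<And>T x xag calls. run T x xag calls \<Longrightarrow> 1 \<le> T \<Longrightarrow>
        real (\<Sum>t=1..T. calls t) \<le> real T * (H + call_rate * ln (real T))"
      using total_calls_bound by blast
    \<comment> \<open>For \<open>ln T \<ge> Y\<close> the logarithm dominates the initial energy, the additive constant in the number of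
      calls, and the difference between \<open>ln T\<close> and \<open>ln (L * B * \<tau> * T)\<close>.\<close>
    define Y where "Y = (initial + 2 * err) / (2 * err) + \<bar>H\<bar> + 2 * \<bar>ln (L * B * \<tau>)\<bar>"
    define T0 where "T0 = Suc (nat \<lceil>exp Y\<rceil>)"
    have exponent: "(\<kappa> * q + \<kappa> - q) / q = P"
      using assms by (simp add: P_eq field_simps)
    show "\<exists>T0>0. \<forall>T\<ge>T0. \<forall>x xag calls. run T x xag calls \<longrightarrow>
         \<bar>F (xag (Suc T)) - F xs\<bar> \<le>
           M1 * (L * \<tau> powr q * B powr (\<kappa> / q) *
                 (ln (real T) / real T powr ((\<kappa> * q + \<kappa> - q) / q))) \<and>
         real (\<Sum>t=1..T. calls t) \<le> M2 * (real T * ln (L * B * \<tau> * real T))"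
    proof (intro exI[of _ T0] conjI allI impI)
      show "0 < T0"
        by (simp add: T0_def)
      fix T x xag calls
      assume T: "T0 \<le> T" and run: "run T x xag calls"
      have "1 \<le> T" and "exp Y \<le> real T"
        using T unfolding T0_def by linarith+
      then have Y: "Y \<le> ln (real T)"
        using ln_mono[of "exp Y" "real T"] by simp
      have parts: "0 \<le> (initial + 2 * err) / (2 * err)"
        using initial_nonneg err_pos by simp
      have lnT: "0 \<le> ln (real T)"
        using \<open>1 \<le> T\<close> by simp
      have "(initial + 2 * err) / (2 * err) \<le> ln (real T)"
        using Y unfolding Y_def by linarith
      then have "initial + 2 * err \<le> 2 * err * ln (real T)"
        using err_pos by (simp add: field_simps)
      then have "\<bar>F (xag (Suc T)) - F xs\<bar>
          \<le> gap_constant * (L * \<tau> powr q * B powr (\<kappa> / q) * (ln (real T) / real T powr P))"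
        using gap_bound[OF run \<open>1 \<le> T\<close>] by blast
      also have "\<dots> \<le> M1 * (L * \<tau> powr q * B powr (\<kappa> / q) * (ln (real T) / real T powr P))"
        using parameter_ranges lnT by (intro mult_right_mono) (auto simp: M1_def)
      finally show "\<bar>F (xag (Suc T)) - F xs\<bar> \<le> M1 * (L * \<tau> powr q * B powr (\<kappa> / q) *
          (ln (real T) / real T powr ((\<kappa> * q + \<kappa> - q) / q)))"
        unfolding exponent .
      have half: "ln (real T) \<le> 2 * ln (L * B * \<tau> * real T)"
      proof -
        have "2 * \<bar>ln (L * B * \<tau>)\<bar> \<le> ln (real T)"
          using Y parts unfolding Y_def by linarith
        moreover have "ln (L * B * \<tau> * real T) = ln (L * B * \<tau>) + ln (real T)"
          using parameter_ranges B_pos \<open>1 \<le> T\<close> by (intro ln_mult_pos) auto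
        ultimately show ?thesis
          by linarith
      qed
      have "H + call_rate * ln (real T) \<le> ln (real T) + \<bar>call_rate\<bar> * ln (real T)"
        using Y parts lnT unfolding Y_def by (intro add_mono mult_right_mono) auto
      also have "\<dots> = (1 + \<bar>call_rate\<bar>) * ln (real T)"
        by (simp add: algebra_simps)
      also have "\<dots> \<le> (1 + \<bar>call_rate\<bar>) * (2 * ln (L * B * \<tau> * real T))"
        using half by (rule mult_left_mono) simp
      finally have "real T * (H + call_rate * ln (real T)) \<le> real T * (M2 * ln (L * B * \<tau> * real T))"
        by (intro mult_left_mono) (auto simp: M2_def algebra_simps)
      then show "real (\<Sum>t=1..T. calls t) \<le> M2 * (real T * ln (L * B * \<tau> * real T))"
        using H[OF run \<open>1 \<le> T\<close>] by (simp add: mult.left_commute)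
    qed
  qed
qed

end
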